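(* Let $G=\mathbb{R}^n$ or $G=\mathrm{H}^{2n+1}$, and let $\mathbb{R}^m\ltimes_{\mathcal A}G$ be the associated Riemannian Lie group. (i) Define the complex-valued function $\psi : \mathbb{R}^m \ltimes_{\mathcal A} G \to \mathbb{C}$ by $$\begin{cases} \psi(x) = a + \sum_i v_i x_i + \sum_{ij} B_{ij}x_ix_j & \text{if } G= \mathbb{R}^n,\\ \psi(\xi,x) = a + b\,\xi + \sum_i v_i x_i + \sum_{ij} B_{ij}x_ix_j & \text{if } G= \mathrm{H}^{2n+1}, \end{cases}$$ where the coefficients $a,v_i,B_{ij}\in\mathbb{C}$ (and $b\in\mathbb{C}$ when $G=\mathrm{H}^{2n+1}$) are not all zero and the coefficients $B_{ij}$ form a symmetric matrix $B$ such that $$\operatorname{Tr} (\mu(t)\,\mu(t)^{T} B) = 0, \quad t \in \mathbb{R}^m.$$ Here $1\le i,j\le n$ if $G=\mathbb{R}^n$ and $1\le i,j\le 2n$ if $G=\mathrm{H}^{2n+1}$. Then $\psi$ is proper harmonic (i.e. proper $1$-harmonic) on $\mathbb{R}^m \ltimes_{\mathcal A} G$. (ii) Let $(r_k)_{k=1}^m$ be a collection of positive integers and define the complex-valued functions $\phi_{k} : \mathbb{R}^m \ltimes_{\mathcal A} G\to \mathbb{C}$ by $$\phi_{k}(t_k) = \begin{cases} c_1 \, t_k^{r_k-1} e^{\omega_k t_k} + c_{2} \, t_k^{r_k-1} & \text{if }\;\omega_k \neq 0,\\ c_1 \, t_k^{2r_k-1} + c_{2} \, t_k^{2r_k-2}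 & \text{if }\;\omega_k = 0, \end{cases}$$ where $c = (c_1, c_2) \in \mathbb{C}^2$ is non-zero. Then for each $k = 1,\ldots, m$, the function $\phi_{k}$ is proper $r_k$-harmonic on $\mathbb{R}^m \ltimes_{\mathcal A} G$. Furthermore, their product $$\prod_{k=1}^m \phi_k(t_k)$$ is proper $(r_1 + \ldots + r_m -m+1)$-harmonic on $\mathbb{R}^m \ltimes_{\mathcal A} G$.
   Context: For a Riemannian manifold $(M,g)$ and smooth $\phi:M\to\mathbb{C}$, $\tau(\phi)=\operatorname{div}(\nabla\phi)$ is the Laplace-Beltrami operator (extended complex linearly), $\tau^0(\phi)=\phi$, $\tau^r(\phi)=\tau(\tau^{r-1}(\phi))$. For an integer $r\ge1$, $\phi$ is proper $r$-harmonic if $\tau^r(\phi)=0$ and $\tau^{r-1}(\phi)$ does not vanish identically. The groups. Let $m,n\ge1$, and let $\mathcal A=(A_k)_{k=1}^m$ be a commuting family of invertible real matrices, of size $n\times n$ if $G=\mathbb{R}^n$ and $2n\times2n$ if $G=\mathrm{H}^{2n+1}$. Put $\mu(t)=\operatorname{Exp}\left(\sum_{k=1}^m A_kt_k\right)$ for $t\in\mathbb{R}^m$. Case $G=\mathbb{R}^n$: $\mathbb{R}^m\ltimes_{\mathcal A}\mathbb{R}^n$ is the manifold $\mathbb{R}^m\times\mathbb{R}^n$ with coordinates $(t,x)$ and group operation $(t,x)(s,y)=(t+s,\,x+\mu(t)y)$, equipped with the left-invariant Riemannian metric for which $\partial/\partial t_k|_0,\ \partial/\partial x_i|_0$ form an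 orthonormal basis of the Lie algebra; in coordinates $g_{(t,x)}=\begin{bmatrix} I_m&0\\0&\mu(-t)^{T}\mu(-t)\end{bmatrix}$. Case $G=\mathrm{H}^{2n+1}$ (the $(2n+1)$-dimensional Heisenberg group): let $J_{2n}$ be the $2n\times 2n$ matrix with $J_{2n}x=(-x_2,x_1,\ldots,-x_{2n},x_{2n-1})$. Each $A_k$ is assumed to be of the following form: written as an $n\times n$ array of $2\times2$ blocks, its $(i,j)$ block is $A_{(i,j)}$ for $i\ge j$ and $-\operatorname{adj}(A_{(j,i)})$ for $i<j$, where $A_{(i,j)}\in\mathbb{R}^{2\times2}$ $(i\ge j)$, the traces $\operatorname{Tr}A_{(i,i)}$ are the same for all $1\le i\le n$, and $\operatorname{adj}$ is the adjugate matrix. Put $a(t)=\exp\left(\frac1n\sum_{k=1}^m\operatorname{Tr}(A_k)t_k\right)$. Then $\mathbb{R}^m\ltimes_{\mathcal A}\mathrm{H}^{2n+1}$ is the manifold $\mathbb{R}^m\times\mathbb{R}\times\mathbb{R}^{2n}$ with coordinates $(t,\xi,x)$ and group operation $$(t,\xi,x)(s,\eta,y)=\left(t+s,\ \xi+a(t)\eta+\tfrac12\langle J_{2n}x,\mu(t)y\rangle,\ x+\mu(t)y\right),$$ equipped with the left-invariant Riemannian metric for which $\partial/\partial t_k|_0,\ \partial/\partial\xi|_0,\ \partial/\partial x_i|_0$ form an orthonormal basis of the Lie algebra. (The function $a(t)$ is unrelated to the constant $a$ in the claim.) The vector $\omega=(\omega_1,\ldots,\omega_m)\in\mathbb{R}^m$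 is $\omega=(\operatorname{Tr}(A_1),\ldots,\operatorname{Tr}(A_m))$ if $G=\mathbb{R}^n$ and $\omega=\frac{n+1}{n}(\operatorname{Tr}(A_1),\ldots,\operatorname{Tr}(A_m))$ if $G=\mathrm{H}^{2n+1}$. *)

theory Defs
  imports "HOL-Analysis.Analysis"
begin

text \<open>
  All manifolds below carry a global chart with values in \<open>real^'k\<close>; a Riemannian metric is given
  by its coefficient matrix \<open>g p = (g\<^sub>i\<^sub>j(p))\<close> with respect to the coordinate vector fields.
\<close>

definition jacobian :: "(real^'a \<Rightarrow> real^'b) \<Rightarrow> real^'a \<Rightarrow> real^'a^'b" where
  "jacobian f p = matrix (frechet_derivative f (at p))"

definition partial :: "'k \<Rightarrow> (real^'k \<Rightarrow> real) \<Rightarrow> real^'k \<Rightarrow> real" where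
  "partial i f p = frechet_derivative f (at p) (axis i 1)"

primrec times_cont_diff ::
  "nat \<Rightarrow> ('a::real_normed_vector \<Rightarrow> 'b::real_normed_vector) \<Rightarrow> bool" where
  "times_cont_diff 0 f \<longleftrightarrow> continuous_on UNIV f"
| "times_cont_diff (Suc j) f \<longleftrightarrow>
     f differentiable_on UNIV \<and> (\<forall>v. times_cont_diff j (\<lambda>p. frechet_derivative f (at p) v))"

definition smooth :: "('a::real_normed_vector \<Rightarrow> 'b::real_normed_vector) \<Rightarrow> bool" where
  "smooth f \<longleftrightarrow> (\<forall>j. times_cont_diff j f)"

text \<open>The gradient is the vector field with \<open>g(\<nabla>f, \<cdot>) = df\<close>, i.e. \<open>(\<nabla>f)\<^sup>i = \<Sum>\<^sub>j g\<^sup>i\<^sup>j \<partial>\<^sub>j f\<close>.\<close>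

definition riemannian_gradient ::
  "(real^'k \<Rightarrow> real^'k^'k) \<Rightarrow> (real^'k \<Rightarrow> real) \<Rightarrow> real^'k \<Rightarrow> real^'k" where
  "riemannian_gradient g f p = matrix_inv (g p) *v (\<chi> i. partial i f p)"

text \<open>The divergence with respect to the Riemannian volume \<open>sqrt (det g) dp\<close>.\<close>

definition riemannian_divergence ::
  "(real^'k \<Rightarrow> real^'k^'k) \<Rightarrow> (real^'k \<Rightarrow> real^'k) \<Rightarrow> real^'k \<Rightarrow> real" where
  "riemannian_divergence g X p =
     (\<Sum>i\<in>UNIV. partial i (\<lambda>q. sqrt (det (g q)) * X q $ i) p) / sqrt (det (g p))"

definition laplace_beltrami_real ::
  "(real^'k \<Rightarrow> real^'k^'k) \<Rightarrow> (real^'k \<Rightarrow> real) \<Rightarrow> real^'k \<Rightarrow> real" where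
  "laplace_beltrami_real g f = riemannian_divergence g (riemannian_gradient g f)"

definition laplace_beltrami ::
  "(real^'k \<Rightarrow> real^'k^'k) \<Rightarrow> (real^'k \<Rightarrow> complex) \<Rightarrow> real^'k \<Rightarrow> complex" where
  "laplace_beltrami g f p =
     Complex (laplace_beltrami_real g (\<lambda>q. Re (f q)) p) (laplace_beltrami_real g (\<lambda>q. Im (f q)) p)"

definition proper_harmonic ::
  "(real^'k \<Rightarrow> real^'k^'k) \<Rightarrow> nat \<Rightarrow> (real^'k \<Rightarrow> complex) \<Rightarrow> bool" where
  "proper_harmonic g r f \<longleftrightarrow>
     r \<ge> 1 \<and> smooth f \<and>
     (\<forall>p. (laplace_beltrami g ^^ r) f p = 0) \<and>
     (\<exists>p. (laplace_beltrami g ^^ (r - 1)) f p \<noteq> 0)"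

text \<open>
  For a Lie group structure on \<open>real^'k\<close> with multiplication \<open>mul\<close> and neutral element \<open>0\<close>, the
  left-invariant metric for which the coordinate basis at \<open>0\<close> is orthonormal: with
  \<open>D = d(L\<^sub>p)\<^sub>0\<close> the differential at \<open>0\<close> of left translation by \<open>p\<close>, it is determined by
  \<open>g\<^sub>p(D u, D v) = \<langle>u, v\<rangle>\<close>, hence \<open>g\<^sub>p(u, v) = \<langle>D\<^sup>-\<^sup>1 u, D\<^sup>-\<^sup>1 v\<rangle>\<close>.
\<close>

definition left_invariant_metric ::
  "(real^'k \<Rightarrow> real^'k \<Rightarrow> real^'k) \<Rightarrow> real^'k \<Rightarrow> real^'k^'k" where
  "left_invariant_metric mul p =
     transpose (matrix_inv (jacobian (mul p) 0)) ** matrix_inv (jacobian (mul p) 0)"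

lemma left_invariant_metric_invariant:
  fixes mul :: "real^'k \<Rightarrow> real^'k \<Rightarrow> real^'k"
  assumes assoc: "\<And>p q s. mul (mul p q) s = mul p (mul q s)"
    and unit: "\<And>p. mul p 0 = p"
    and diff: "\<And>p q. mul p differentiable at q"
    and inv: "\<And>p. invertible (jacobian (mul p) 0)"
  shows "transpose (jacobian (mul p) q) ** left_invariant_metric mul (mul p q) ** jacobian (mul p) q
           = left_invariant_metric mul q"
proof -
  have matinv: "M ** matrix_inv M = mat 1 \<and> matrix_inv M ** M = mat 1"
    if "invertible M" for M :: "real^'k^'k"
    using someI_ex[OF that[unfolded invertible_def]] by (simp add: matrix_inv_def)
  let ?D = "\<lambda>p. jacobian (mul p) 0" and ?J = "jacobian (mul p) q"
  have der: "(mul p has_derivative frechet_derivative (mul p) (at s)) (at s)" for p s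
    using diff frechet_derivative_works by blast
  have "mul (mul p q) = mul p \<circ> mul q"
    by (simp add: fun_eq_iff assoc)
  moreover have "(mul p \<circ> mul q has_derivative
      frechet_derivative (mul p) (at q) \<circ> frechet_derivative (mul q) (at 0)) (at 0)"
    using diff_chain_at[OF der[of q 0], of "mul p"] der[of p q] by (simp add: unit)
  ultimately have "frechet_derivative (mul (mul p q)) (at 0)
      = frechet_derivative (mul p) (at q) \<circ> frechet_derivative (mul q) (at 0)"
    using frechet_derivative_at by metis
  then have D: "?D (mul p q) = ?J ** ?D q"
    unfolding jacobian_def
    by (metis der has_derivative_linear matrix_compose)
  have i1: "?D q ** matrix_inv (?D q) = mat 1" "matrix_inv (?D q) ** ?D q = mat 1"
    using matinv[OF inv] by blast+
  have i2: "matrix_inv (?D (mul p q)) ** ?D (mul p q) = mat 1"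
    using matinv[OF inv] by blast
  have "?J = ?D (mul p q) ** matrix_inv (?D q)"
    by (simp add: D flip: matrix_mul_assoc) (simp add: i1)
  then have *: "matrix_inv (?D (mul p q)) ** ?J = matrix_inv (?D q)"
    by (simp add: matrix_mul_assoc i2)
  show ?thesis
    unfolding left_invariant_metric_def
    by (metis * matrix_mul_assoc matrix_transpose_mul)
qed

lemma left_invariant_metric_unit:
  assumes "\<And>q. mul 0 q = q"
  shows "left_invariant_metric mul 0 = mat 1"
proof -
  have "mul 0 = id" using assms by auto
  then have J: "jacobian (mul 0) 0 = mat 1"
    by (simp add: jacobian_def id_def frechet_derivative_ident
        matrix_id_mat_1[unfolded id_def])
  have "\<exists>N::real^'a^'a. mat 1 ** N = mat 1 \<and> N ** mat 1 = mat 1"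
    by (metis matrix_mul_lid)
  from someI_ex[OF this] have "matrix_inv (mat 1 :: real^'a^'a) = mat 1"
    by (simp add: matrix_inv_def matrix_mul_lid)
  then show ?thesis
    by (simp add: left_invariant_metric_def J transpose_mat)
qed

text \<open>
  The type \<open>real^'d^'d\<close> is not a Banach algebra under matrix multiplication in the library, so
  \<open>exp\<close> is not available for matrices.
\<close>

definition matrix_pow :: "real^'d^'d \<Rightarrow> nat \<Rightarrow> real^'d^'d" where
  "matrix_pow M j = (((**) M) ^^ j) (mat 1)"

definition matrix_exp :: "real^'d^'d \<Rightarrow> real^'d^'d" where
  "matrix_exp M = (\<Sum>j. (1 / fact j) *\<^sub>R matrix_pow M j)"

definition commuting_invertible_family :: "('m \<Rightarrow> real^'d^'d) \<Rightarrow> bool" where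
  "commuting_invertible_family A \<longleftrightarrow>
     (\<forall>k. invertible (A k)) \<and> (\<forall>j k. A j ** A k = A k ** A j)"

definition mu :: "('m::finite \<Rightarrow> real^'d^'d) \<Rightarrow> real^'m \<Rightarrow> real^'d^'d" where
  "mu A t = matrix_exp (\<Sum>k\<in>UNIV. t $ k *\<^sub>R A k)"

definition complex_matrix :: "real^'d^'d \<Rightarrow> complex^'d^'d" where
  "complex_matrix M = (\<chi> i j. complex_of_real (M $ i $ j))"

text \<open>The point \<open>(t, x)\<close> is the vector with components \<open>t\<^sub>k\<close> at \<open>Inl k\<close> and \<open>x\<^sub>i\<close> at \<open>Inr i\<close>.\<close>

definition pair_Rn :: "real^'m::finite \<Rightarrow> real^'n::finite \<Rightarrow> real^('m + 'n)" where
  "pair_Rn t x = (\<chi> s. case s of Inl k \<Rightarrow> t $ k | Inr i \<Rightarrow> x $ i)"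

definition t_part :: "real^('m::finite + 'l::finite) \<Rightarrow> real^'m" where
  "t_part p = (\<chi> k. p $ Inl k)"

definition x_Rn :: "real^('m::finite + 'n::finite) \<Rightarrow> real^'n" where
  "x_Rn p = (\<chi> i. p $ Inr i)"

definition mul_Rn ::
  "('m::finite \<Rightarrow> real^'n::finite^'n) \<Rightarrow> real^('m + 'n) \<Rightarrow> real^('m + 'n) \<Rightarrow> real^('m + 'n)" where
  "mul_Rn A p q = pair_Rn (t_part p + t_part q) (x_Rn p + mu A (t_part p) *v x_Rn q)"

definition metric_Rn ::
  "('m::finite \<Rightarrow> real^'n::finite^'n) \<Rightarrow> real^('m + 'n) \<Rightarrow> real^('m + 'n)^('m + 'n)" where
  "metric_Rn A = left_invariant_metric (mul_Rn A)"

definition omega_Rn :: "('m::finite \<Rightarrow> real^'n::finite^'n) \<Rightarrow> 'm \<Rightarrow> real" where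
  "omega_Rn A k = trace (A k)"

text \<open>
  The index type \<open>'n \<times> 2\<close> stands for \<open>{1..2n}\<close>: the pairs \<open>(i, 1)\<close> and \<open>(i, 2)\<close> are the indices
  \<open>2i - 1\<close> and \<open>2i\<close>, so the first component of a pair selects a 2 by 2 block of a matrix.
\<close>

definition J2n :: "real^('n::finite \<times> 2) \<Rightarrow> real^('n \<times> 2)" where
  "J2n x = (\<chi> s. if snd s = 1 then - x $ (fst s, 2) else x $ (fst s, 1))"

definition block :: "real^('n::finite \<times> 2)^('n \<times> 2) \<Rightarrow> 'n \<Rightarrow> 'n \<Rightarrow> real^2^2" where
  "block M i j = (\<chi> a b. M $ (i, a) $ (j, b))"

definition adjugate2 :: "real^2^2 \<Rightarrow> real^2^2" where
  "adjugate2 M = vector [vector [M $ 2 $ 2, - M $ 1 $ 2], vector [- M $ 2 $ 1, M $ 1 $ 1]]"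

definition heisenberg_form :: "real^('n::{finite,linorder} \<times> 2)^('n \<times> 2) \<Rightarrow> bool" where
  "heisenberg_form M \<longleftrightarrow>
     (\<forall>i j. i < j \<longrightarrow> block M i j = - adjugate2 (block M j i)) \<and>
     (\<forall>i j. trace (block M i i) = trace (block M j j))"

text \<open>The point \<open>(t, \<xi>, x)\<close> has the component \<open>\<xi>\<close> at index \<open>Inr (Inl ())\<close>.\<close>

definition triple_H :: "real^'m::finite \<Rightarrow> real \<Rightarrow> real^('n::finite \<times> 2) \<Rightarrow> real^('m + unit + 'n \<times> 2)" where
  "triple_H t \<xi> x =
     (\<chi> s. case s of Inl k \<Rightarrow> t $ k | Inr u \<Rightarrow> (case u of Inl _ \<Rightarrow> \<xi> | Inr i \<Rightarrow> x $ i))"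

definition xi_H :: "real^('m::finite + unit + 'n::finite \<times> 2) \<Rightarrow> real" where
  "xi_H p = p $ Inr (Inl ())"

definition x_H :: "real^('m::finite + unit + 'n::finite \<times> 2) \<Rightarrow> real^('n \<times> 2)" where
  "x_H p = (\<chi> i. p $ Inr (Inr i))"

definition a_H :: "('m::finite \<Rightarrow> real^('n::finite \<times> 2)^('n \<times> 2)) \<Rightarrow> real^'m \<Rightarrow> real" where
  "a_H A t = exp (1 / real CARD('n) * (\<Sum>k\<in>UNIV. trace (A k) * t $ k))"

definition mul_H ::
  "('m::finite \<Rightarrow> real^('n::finite \<times> 2)^('n \<times> 2)) \<Rightarrow>
     real^('m + unit + 'n \<times> 2) \<Rightarrow> real^('m + unit + 'n \<times> 2) \<Rightarrow> real^('m + unit + 'n \<times> 2)" where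
  "mul_H A p q =
     triple_H (t_part p + t_part q)
       (xi_H p + a_H A (t_part p) * xi_H q
          + 1 / 2 * (J2n (x_H p) \<bullet> (mu A (t_part p) *v x_H q)))
       (x_H p + mu A (t_part p) *v x_H q)"

definition metric_H ::
  "('m::finite \<Rightarrow> real^('n::finite \<times> 2)^('n \<times> 2)) \<Rightarrow>
     real^('m + unit + 'n \<times> 2) \<Rightarrow> real^('m + unit + 'n \<times> 2)^('m + unit + 'n \<times> 2)" where
  "metric_H A = left_invariant_metric (mul_H A)"

definition omega_H :: "('m::finite \<Rightarrow> real^('n::finite \<times> 2)^('n \<times> 2)) \<Rightarrow> 'm \<Rightarrow> real" where
  "omega_H A k = (real CARD('n) + 1) / real CARD('n) * trace (A k)"

definition phi :: "complex \<Rightarrow> complex \<Rightarrow> real \<Rightarrow> nat \<Rightarrow> real \<Rightarrow> complex" where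
  "phi c1 c2 w r t =
     (if w \<noteq> 0
      then c1 * complex_of_real (t ^ (r - 1) * exp (w * t)) + c2 * complex_of_real (t ^ (r - 1))
      else c1 * complex_of_real (t ^ (2 * r - 1)) + c2 * complex_of_real (t ^ (2 * r - 2)))"

end

theory Submission
  imports Defs
begin

text \<open>
  Left translation by \<open>p\<close> is affine, \<open>p q = p + D(p) q\<close>, so the inverse of the metric is \<open>D D\<^sup>T\<close>. As
  \<open>D\<close> solves a linear differential equation \<open>D'(p) h = N(p, h) D(p)\<close> with
  \<open>tr N(p, h) = \<Sum>\<^sub>k \<omega>\<^sub>k h\<^sub>k\<close>, Jacobi's formula shows that the Riemannian volume has density
  \<open>exp (- \<Sum>\<^sub>k \<omega>\<^sub>k t\<^sub>k)\<close>. On functions of \<open>t\<close> the Laplacian is therefore the sum of the commuting operators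
  \<open>L\<^sub>k = \<partial>\<^sub>k\<^sup>2 - \<omega>\<^sub>k \<partial>\<^sub>k\<close>, and \<open>L\<^sub>k\<close> is nilpotent of exact order \<open>r\<^sub>k\<close> on \<open>\<phi>\<^sub>k\<close>. Expanding the powers of
  the sum, each term of degree above \<open>\<Sum>\<^sub>k (r\<^sub>k - 1)\<close> vanishes on the product of the \<open>\<phi>\<^sub>k\<close>, and in that
  degree only \<open>\<Prod>\<^sub>k L\<^sub>k\<^bsup>r\<^sub>k-1\<^esup> \<phi>\<^sub>k\<close> survives, with a positive multiplicity. On quadratic functions of \<open>(\<xi>, x)\<close>
  the Laplacian is \<open>2 tr(\<mu> \<mu>\<^sup>T B)\<close>; the contribution of the \<open>\<xi>\<close>-derivative is \<open>b/2\<close> times the trace of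
  the product of the symmetric \<open>\<mu> \<mu>\<^sup>T\<close> with the antisymmetric \<open>J\<close>, hence zero.
\<close>

section \<open>The matrix exponential and the derivative of the determinant\<close>

text \<open>In finite dimension bilinearity implies boundedness; the interpretation that follows
  supplies the product rule and the distributive laws for matrices.\<close>

lemma bounded_bilinear_matrix_matrix_mult:
  "bounded_bilinear ((**) :: real^'b^'a \<Rightarrow> real^'c^'b \<Rightarrow> real^'c^'a)"
  unfolding bilinear_conv_bounded_bilinear[symmetric] bilinear_def
  by (auto intro!: linearI simp: matrix_add_ldistrib matrix_matrix_mult_def vec_eq_iff
      sum.distrib distrib_right distrib_left sum_distrib_left mult_ac)

interpretation matrix_mult: bounded_bilinear "(**) :: real^'b^'a \<Rightarrow> real^'c^'b \<Rightarrow> real^'c^'a"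
  by (rule bounded_bilinear_matrix_matrix_mult)

text \<open>A vector is the sum of its components placed on the axes, and \<open>axis i\<close> is
  an isometry, hence bounded linear. The component type is arbitrary, so rows of a matrix are
  covered.\<close>

lemma has_derivative_vec:
  fixes f :: "'a::real_normed_vector \<Rightarrow> ('b::real_normed_vector)^'n"
  assumes "\<And>i. ((\<lambda>x. f x $ i) has_derivative (\<lambda>h. f' h $ i)) F"
  shows "(f has_derivative f') F"
proof -
  have "bounded_linear (axis i :: 'b \<Rightarrow> 'b^'n)" for i
  proof -
    have "(norm ((axis i x :: 'b^'n) $ j))\<^sup>2 = (if j = i then (norm x)\<^sup>2 else 0)" for x :: 'b and j
      by (simp add: axis_def)
    then have "norm (axis i x :: 'b^'n) = sqrt (\<Sum>j\<in>UNIV. if j = i then (norm x)\<^sup>2 else 0)" for x :: 'b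
      by (simp only: norm_vec_def L2_set_def)
    then have "norm (axis i x :: 'b^'n) = norm x" for x :: 'b
      by simp
    then show ?thesis
      by (intro bounded_linear_intro[where K = 1]) (simp_all add: axis_def vec_eq_iff)
  qed
  then have "((\<lambda>x. \<Sum>i\<in>UNIV. axis i (f x $ i)) has_derivative (\<lambda>h. \<Sum>i\<in>UNIV. axis i (f' h $ i))) F"
    by (intro has_derivative_sum bounded_linear.has_derivative[OF _ assms])
  moreover have "(\<Sum>i\<in>UNIV. axis i (y $ i)) = y" for y :: "'b^'n"
    by (simp add: vec_eq_iff axis_def if_distrib sum.delta cong: if_cong)
  ultimately show ?thesis by simp
qed

lemma matrix_pow_0 [simp]: "matrix_pow M 0 = mat 1"
  by (simp add: matrix_pow_def)

lemma matrix_pow_Suc [simp]: "matrix_pow M (Suc j) = M ** matrix_pow M j"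
  by (simp add: matrix_pow_def)

text \<open>As \<open>S h\<close> commutes with \<open>S t\<close>, it can be moved to the front,
  where the summands of the product rule coincide.\<close>

lemma has_derivative_matrix_pow:
  fixes S :: "'a::real_normed_vector \<Rightarrow> real^'d^'d"
  assumes lin: "bounded_linear S" and comm: "\<And>s t. S s ** S t = S t ** S s"
  shows "((\<lambda>t. matrix_pow (S t) (Suc j)) has_derivative
           (\<lambda>h. real (Suc j) *\<^sub>R (S h ** matrix_pow (S t) j))) (at t)"
proof (induction j)
  case 0
  show ?case using bounded_linear.has_derivative[OF lin has_derivative_ident] by simp
next
  case (Suc j)
  have "((\<lambda>t. S t ** matrix_pow (S t) (Suc j)) has_derivative
      (\<lambda>h. S t ** (real (Suc j) *\<^sub>R (S h ** matrix_pow (S t) j)) + S h ** matrix_pow (S t) (Suc j))) (at t)"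
    by (rule matrix_mult.FDERIV[OF bounded_linear.has_derivative[OF lin has_derivative_ident] Suc])
  moreover have "S t ** (S h ** matrix_pow (S t) j) = S h ** matrix_pow (S t) (Suc j)" for h
    by (metis comm matrix_mul_assoc matrix_pow_Suc)
  moreover have "x + real (Suc j) *\<^sub>R x = real (Suc (Suc j)) *\<^sub>R x" for x :: "real^'d^'d"
    by (simp only: of_nat_Suc[of "Suc j"] scaleR_left_distrib scaleR_one)
  ultimately show ?case
    by (simp add: matrix_mult.scaleR_right add.commute del: of_nat_Suc)
qed

text \<open>\<open>K\<close> is a bound of the bilinear product, and the norm of
  \<open>mat 1\<close> enters because it need not be 1.\<close>

lemma norm_matrix_pow_bound:
  obtains K :: real where "K > 0"
    "\<And>(M :: real^'d^'d) j. norm (matrix_pow M j) \<le> norm (mat 1 :: real^'d^'d) * (norm M * K) ^ j"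
proof -
  obtain K where K: "K > 0" "\<And>(M :: real^'d^'d) (N :: real^'d^'d). norm (M ** N) \<le> norm M * norm N * K"
    using matrix_mult.pos_bounded by blast
  have "norm (matrix_pow M j) \<le> norm (mat 1 :: real^'d^'d) * (norm M * K) ^ j" for M :: "real^'d^'d" and j
  proof (induction j)
    case (Suc j)
    have "norm (matrix_pow M (Suc j)) \<le> norm M * norm (matrix_pow M j) * K"
      using K by simp
    also have "\<dots> \<le> norm M * (norm (mat 1 :: real^'d^'d) * (norm M * K) ^ j) * K"
      using Suc K by (intro mult_right_mono mult_left_mono) auto
    finally show ?case by (simp add: algebra_simps)
  qed simp
  with K that show ?thesis by blast
qed

text \<open>A multiple of the scalar exponential series of \<open>R * K\<close> is a majorant on the
  ball. Uniformity is what term-by-term differentiation needs.\<close>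

lemma uniform_limit_matrix_exp:
  "uniform_limit (cball (0 :: real^'d^'d) R) (\<lambda>n M. \<Sum>i<n. (1 / fact i) *\<^sub>R matrix_pow M i) matrix_exp sequentially"
proof -
  obtain K where K: "K > 0" "\<And>(M :: real^'d^'d) j.
      norm (matrix_pow M j) \<le> norm (mat 1 :: real^'d^'d) * (norm M * K) ^ j"
    using norm_matrix_pow_bound by blast
  have "norm ((1 / fact i) *\<^sub>R matrix_pow M i) \<le> norm (mat 1 :: real^'d^'d) * ((R * K) ^ i /\<^sub>R fact i)"
    if "M \<in> cball 0 R" for M :: "real^'d^'d" and i
  proof -
    have "norm (matrix_pow M i) \<le> norm (mat 1 :: real^'d^'d) * (R * K) ^ i"
      using K that by (intro order.trans[OF K(2)] mult_left_mono power_mono mult_right_mono) auto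
    then show ?thesis by (simp add: divide_simps mult_ac)
  qed
  moreover have "summable (\<lambda>i. norm (mat 1 :: real^'d^'d) * ((R * K) ^ i /\<^sub>R fact i))"
    by (intro summable_mult summable_exp_generic)
  ultimately show ?thesis
    unfolding matrix_exp_def by (rule Weierstrass_m_test)
qed

lemma matrix_exp_sums: "(\<lambda>i. (1 / fact i) *\<^sub>R matrix_pow M i) sums matrix_exp M"
  using tendsto_uniform_limitI[OF uniform_limit_matrix_exp[of "norm M"], of M]
  by (simp add: sums_def)

lemma matrix_exp_0: "matrix_exp (0 :: real^'d^'d) = mat 1"
proof -
  have "(1 / fact i) *\<^sub>R matrix_pow (0::real^'d^'d) i = (if i = 0 then mat 1 else 0)" for i
    by (cases i) (simp_all add: matrix_mult.zero_left)
  then have "(\<lambda>i. (1 / fact i) *\<^sub>R matrix_pow (0::real^'d^'d) i) sums mat 1"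
    using sums_single[of 0 "\<lambda>_. mat 1 :: real^'d^'d"] by simp
  then show ?thesis
    by (rule sums_unique2[OF matrix_exp_sums])
qed

text \<open>Only for commuting values of \<open>S\<close> may the power series be differentiated term by term
  as in the scalar case.\<close>

lemma has_derivative_matrix_exp:
  fixes S :: "'a::real_normed_vector \<Rightarrow> real^'d^'d"
  assumes lin: "bounded_linear S" and comm: "\<And>s t. S s ** S t = S t ** S s"
  shows "((\<lambda>t. matrix_exp (S t)) has_derivative (\<lambda>h. S h ** matrix_exp (S t))) (at t)"
proof -
  \<comment> \<open>A ball is bounded, which gives uniform convergence on it, and open, so that
    derivatives within it are derivatives at \<open>t\<close>.\<close>
  define U where "U = ball (0::'a) (norm t + 1)"
  define f' where "f' = (\<lambda>n t h. case n of 0 \<Rightarrow> 0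
      | Suc j \<Rightarrow> (1 / fact j) *\<^sub>R (S h ** matrix_pow (S t) j))"
  obtain B where B: "B > 0" "\<And>h. norm (S h) \<le> norm h * B"
    using bounded_linear.pos_bounded[OF lin] by blast
  obtain K where K: "K > 0" "\<And>(M :: real^'d^'d) (N :: real^'d^'d). norm (M ** N) \<le> norm M * norm N * K"
    using matrix_mult.pos_bounded by blast
  have tU: "t \<in> U" by (simp add: U_def)
  have deriv: "((\<lambda>t. (1 / fact n) *\<^sub>R matrix_pow (S t) n) has_derivative f' n t) (at t within U)" for n t
  proof (cases n)
    case (Suc j)
    have "((\<lambda>t. (1 / fact n) *\<^sub>R matrix_pow (S t) n) has_derivative
        (\<lambda>h. (1 / fact n) *\<^sub>R (real (Suc j) *\<^sub>R (S h ** matrix_pow (S t) j)))) (at t within U)"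
      unfolding Suc
      by (rule has_derivative_scaleR_right[OF has_derivative_at_withinI[OF has_derivative_matrix_pow[OF lin comm]]])
    then show ?thesis by (simp add: f'_def Suc)
  qed (simp add: f'_def)
  have "\<forall>\<^sub>F n in sequentially. \<forall>x\<in>U. \<forall>h.
      norm ((\<Sum>i<n. f' i x h) - S h ** matrix_exp (S x)) \<le> e * norm h" if "e > 0" for e
  proof -
    let ?E = "\<lambda>n M. \<Sum>i<n. (1 / fact i) *\<^sub>R matrix_pow M i :: real^'d^'d"
    have "\<forall>\<^sub>F n in sequentially. \<forall>M\<in>cball 0 ((norm t + 1) * B). dist (?E n M) (matrix_exp M) < e / (B * K)"
      by (rule uniform_limitD[OF uniform_limit_matrix_exp]) (use that B K in simp)
    then have "\<forall>\<^sub>F n in sequentially. \<forall>x\<in>U. \<forall>h.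
      norm ((\<Sum>i<Suc n. f' i x h) - S h ** matrix_exp (S x)) \<le> e * norm h"
    proof eventually_elim
      case (elim n)
      show ?case
      proof safe
        fix x h assume "x \<in> U"
        then have "norm (S x) \<le> (norm t + 1) * B"
          using B by (intro order.trans[OF B(2)] mult_right_mono) (auto simp: U_def)
        then have d: "norm (?E n (S x) - matrix_exp (S x)) < e / (B * K)"
          using elim by (auto simp: dist_norm)
        \<comment> \<open>The index shifts by one: the derivative of term \<open>j + 1\<close> is
          \<open>S h\<close> times term \<open>j\<close>, and the constant term drops out.\<close>
        have "(\<Sum>i<Suc n. f' i x h) = S h ** ?E n (S x)"
          unfolding sum.lessThan_Suc_shift matrix_mult.sum_right matrix_mult.scaleR_right
          by (simp add: f'_def)
        then have "norm ((\<Sum>i<Suc n. f' i x h) - S h ** matrix_exp (S x))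
            = norm (S h ** (?E n (S x) - matrix_exp (S x)))"
          by (simp only: matrix_mult.diff_right)
        also have "\<dots> \<le> norm (S h) * norm (?E n (S x) - matrix_exp (S x)) * K"
          by (rule K(2))
        also have "\<dots> \<le> (norm h * B) * (e / (B * K)) * K"
          using B K d that by (intro mult_right_mono mult_mono) auto
        also have "\<dots> = e * norm h" using B K by simp
        finally show "norm ((\<Sum>i<Suc n. f' i x h) - S h ** matrix_exp (S x)) \<le> e * norm h" .
      qed
    qed
    then show ?thesis by (subst (asm) eventually_sequentially_Suc)
  qed
  from has_derivative_series[of U, OF _ deriv this tU matrix_exp_sums]
  obtain g where g: "\<forall>x\<in>U. (\<lambda>n. (1 / fact n) *\<^sub>R matrix_pow (S x) n) sums g x \<and>
      (g has_derivative (\<lambda>h. S h ** matrix_exp (S x))) (at x within U)"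
    by (auto simp: U_def)
  then have "g x = matrix_exp (S x)" if "x \<in> U" for x
    using that matrix_exp_sums sums_unique2 by blast
  then have "((\<lambda>t. matrix_exp (S t)) has_derivative (\<lambda>h. S h ** matrix_exp (S t))) (at t within U)"
    using has_derivative_transform[OF tU _ bspec[OF g tU, THEN conjunct2]] by metis
  then show ?thesis using at_within_open[OF tU] by (simp add: U_def)
qed

section \<open>The derivative of the determinant\<close>

lemma differentiable_det: "(det :: real^'n^'n \<Rightarrow> real) differentiable at M"
proof -
  have entry: "((\<lambda>M. M $ i $ j) has_derivative (\<lambda>H. H $ i $ j)) (at M)" for i j and M :: "real^'n^'n"
    by (intro bounded_linear.has_derivative[OF bounded_linear_vec_nth] has_derivative_ident)
  show ?thesis
    unfolding det_def differentiable_def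
    by (rule exI, rule has_derivative_sum, rule has_derivative_mult_right,
        rule has_derivative_prod, rule entry)
qed

text \<open>In the Leibniz formula a permutation other than \<open>id\<close> moves at least two
  points, so after one factor is differentiated an off-diagonal entry of the identity
  remains.\<close>

lemma has_derivative_det_mat_1:
  "(det has_derivative trace) (at (mat 1 :: real^'n^'n))"
proof -
  let ?P = "\<lambda>(p::'n \<Rightarrow> 'n) (H::real^'n^'n). of_int (sign p) *
      (\<Sum>i\<in>UNIV. H $ i $ p i * (\<Prod>j\<in>UNIV - {i}. (mat 1 :: real^'n^'n) $ j $ p j))"
  have entry: "((\<lambda>M. M $ i $ j) has_derivative (\<lambda>H. H $ i $ j)) (at (mat 1 :: real^'n^'n))" for i j
    by (intro bounded_linear.has_derivative[OF bounded_linear_vec_nth] has_derivative_ident)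
  have "(det has_derivative (\<lambda>H. \<Sum>p | p permutes UNIV. ?P p H)) (at (mat 1 :: real^'n^'n))"
    unfolding det_def
    by (intro has_derivative_sum has_derivative_mult_right has_derivative_prod entry)
  moreover have "?P p H = (if p = id then trace H else 0)" if "p permutes UNIV" for p H
  proof (cases "p = id")
    case True
    then show ?thesis by (simp add: sign_id trace_def mat_def)
  next
    case False
    have "\<exists>j\<in>UNIV - {i}. p j \<noteq> j" for i
    proof (rule ccontr)
      assume fix_all: "\<not> ?thesis"
      have "p (p i) = p i \<or> p i = i" using fix_all by blast
      then have "p i = i" using permutes_inj[OF that] by (auto dest: injD)
      with fix_all False show False by (auto simp: fun_eq_iff)
    qed
    then have "(\<Prod>j\<in>UNIV - {i}. (mat 1 :: real^'n^'n) $ j $ p j) = 0" for i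
      by (intro prod_zero) (auto simp: mat_def, metis)
    with False show ?thesis by (simp del: prod_zero_iff)
  qed
  ultimately show ?thesis
    by (simp add: sum.delta permutes_id)
qed

text \<open>Jacobi's formula, without the adjugate: along the line \<open>s \<mapsto> M + s N M\<close> the determinant is
  \<open>det (1 + s N) det M\<close>, which reduces it to the derivative at the identity.\<close>

lemma has_derivative_det:
  fixes D :: "'a::real_normed_vector \<Rightarrow> real^'n^'n"
  assumes D: "(D has_derivative (\<lambda>h. N h ** D p)) (at p)"
  shows "((\<lambda>q. det (D q)) has_derivative (\<lambda>h. trace (N h) * det (D p))) (at p)"
proof -
  obtain L where L: "(det has_derivative L) (at (D p))"
    using differentiable_det unfolding differentiable_def by blast
  have "L (N h ** D p) = trace (N h) * det (D p)" for h
  proof -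
    have "((\<lambda>s::real. D p + s *\<^sub>R (N h ** D p)) has_derivative (\<lambda>s. s *\<^sub>R (N h ** D p))) (at 0)"
      by (auto intro!: derivative_eq_intros)
    from has_derivative_compose[OF this, of det L] L
    have "((\<lambda>s::real. det (D p + s *\<^sub>R (N h ** D p))) has_derivative (\<lambda>s. L (s *\<^sub>R (N h ** D p)))) (at 0)"
      by simp
    moreover have "D p + s *\<^sub>R (N h ** D p) = (mat 1 + s *\<^sub>R N h) ** D p" for s
      by (simp add: matrix_mult.add_left matrix_mult.scaleR_left)
    ultimately have 1: "((\<lambda>s::real. det (mat 1 + s *\<^sub>R N h) * det (D p)) has_derivative (\<lambda>s. L (s *\<^sub>R (N h ** D p)))) (at 0)"
      by (simp add: det_mul)
    have "((\<lambda>s::real. mat 1 + s *\<^sub>R N h) has_derivative (\<lambda>s. s *\<^sub>R N h)) (at 0)"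
      by (auto intro!: derivative_eq_intros)
    from has_derivative_compose[OF this, of det trace] has_derivative_det_mat_1
    have "((\<lambda>s::real. det (mat 1 + s *\<^sub>R N h) * det (D p)) has_derivative (\<lambda>s. trace (s *\<^sub>R N h) * det (D p))) (at 0)"
      by (intro has_derivative_mult_left) simp
    from has_derivative_unique[OF 1 this, THEN fun_cong, of 1] show ?thesis by simp
  qed
  with has_derivative_compose[OF D L] show ?thesis by simp
qed

section \<open>The Laplacian in a left-invariant frame\<close>

lemma partial_eq:
  assumes "(f has_derivative f') (at p)"
  shows "partial i f p = f' (axis i 1)"
  using frechet_derivative_at[OF assms] by (simp add: partial_def)

lemma sum_UNIV_Plus:
  "(\<Sum>s\<in>UNIV. f s) = (\<Sum>k\<in>UNIV. f (Inl k)) + (\<Sum>i\<in>UNIV. f (Inr i))"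
  for f :: "'a::finite + 'b::finite \<Rightarrow> 'c::comm_monoid_add"
  by (simp add: UNIV_Plus_UNIV[symmetric] sum.Plus del: UNIV_Plus_UNIV)

lemma sum_axis_mult:
  "(\<Sum>k\<in>UNIV. of_real (axis (Inl j :: 'm::finite + 'l::finite) 1 $ Inl k) * f k) = (f j :: 'b::real_algebra_1)"
proof -
  have "of_real (axis (Inl j :: 'm::finite + 'l::finite) 1 $ Inl k) * f k = (if k = j then f k else 0)" for k
    by (simp add: axis_def)
  then show ?thesis by simp
qed

lemma matrix_inv_eq:
  fixes A B :: "real^'n^'n"
  assumes "A ** B = mat 1"
  shows "matrix_inv A = B"
proof -
  have BA: "B ** A = mat 1" using assms by (simp add: matrix_left_right_inverse)
  then have "A ** matrix_inv A = mat 1"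
    unfolding matrix_inv_def using assms by (metis (mono_tags, lifting) someI_ex)
  then show ?thesis by (metis BA matrix_mul_assoc matrix_mul_lid matrix_mul_rid)
qed

text \<open>\<open>D p\<close> is the differential at \<open>0\<close> of the left translation by \<open>p\<close>; its logarithmic derivative \<open>N\<close>
  determines \<open>det D\<close> through \<open>trace N\<close>, which avoids computing block determinants.\<close>

locale left_invariant_frame =
  fixes g :: "real^('m::finite + 'l::finite) \<Rightarrow> real^('m + 'l)^('m + 'l)"
    and D :: "real^('m + 'l) \<Rightarrow> real^('m + 'l)^('m + 'l)"
    and N :: "real^('m + 'l) \<Rightarrow> real^('m + 'l) \<Rightarrow> real^('m + 'l)^('m + 'l)"
    and w :: "'m \<Rightarrow> real"
  assumes g_eq: "g p = transpose (matrix_inv (D p)) ** matrix_inv (D p)"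
    and D_deriv: "(D has_derivative (\<lambda>h. N p h ** D p)) (at p)"
    and trace_N: "trace (N p h) = (\<Sum>k\<in>UNIV. w k * h $ Inl k)"
    and D_0: "D 0 = mat 1"
    and D_Inl: "D p $ Inl k = axis (Inl k) 1"
    and D_Inr_Inl: "D p $ Inr i $ Inl k = 0"
begin

definition inverse_metric :: "real^('m + 'l) \<Rightarrow> real^('m + 'l)^('m + 'l)" where
  "inverse_metric p = D p ** transpose (D p)"

text \<open>Jacobi's formula and \<open>trace_N\<close> make the quotient of the two sides a
  function with derivative 0, and \<open>D_0\<close> gives it the value 1.\<close>

lemma det_D: "det (D p) = exp (\<Sum>k\<in>UNIV. w k * p $ Inl k)"
proof -
  let ?l = "\<lambda>p::real^('m + 'l). \<Sum>k\<in>UNIV. w k * p $ Inl k"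
  have l: "(?l has_derivative ?l) (at q)" for q
    by (intro has_derivative_sum has_derivative_mult_right
        bounded_linear_imp_has_derivative bounded_linear_vec_nth)
  have "((\<lambda>q. det (D q) * exp (- ?l q)) has_derivative (\<lambda>h. 0)) (at q within UNIV)" for q
  proof -
    have "((\<lambda>q. exp (- ?l q)) has_derivative (\<lambda>h. exp (- ?l q) * - ?l h)) (at q)"
      using has_derivative_exp[OF has_derivative_minus[OF l[of q]]] by (simp add: mult.commute)
    from has_derivative_mult[OF has_derivative_det[OF D_deriv] this]
    show ?thesis by (simp add: trace_N algebra_simps)
  qed
  from has_derivative_zero_unique[OF convex_UNIV this, of p 0]
  have "det (D p) * exp (- ?l p) = 1" by (simp add: D_0)
  then show ?thesis by (simp add: exp_minus field_simps)
qed

lemma D_inverse: "D p ** matrix_inv (D p) = mat 1" "matrix_inv (D p) ** D p = mat 1"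
proof -
  have "invertible (D p)" by (simp add: invertible_det_nz det_D)
  then obtain E where "D p ** E = mat 1" "E ** D p = mat 1" by (auto simp: invertible_def)
  with matrix_inv_eq show "D p ** matrix_inv (D p) = mat 1" "matrix_inv (D p) ** D p = mat 1"
    by metis+
qed

lemma matrix_inv_metric: "matrix_inv (g p) = inverse_metric p"
proof (rule matrix_inv_eq)
  have "transpose (matrix_inv (D p)) ** transpose (D p) = mat 1"
    by (metis D_inverse(1) matrix_transpose_mul transpose_mat)
  then show "g p ** inverse_metric p = mat 1"
    unfolding g_eq inverse_metric_def by (metis D_inverse(2) matrix_mul_assoc matrix_mul_lid)
qed

text \<open>\<open>det g\<close> is the square of \<open>1 / det D\<close>, and \<open>det D\<close>
  is positive, so the root is \<open>1 / det D\<close>.\<close>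

lemma sqrt_det_metric: "sqrt (det (g p)) = exp (- (\<Sum>k\<in>UNIV. w k * p $ Inl k))"
proof -
  have "det (matrix_inv (D p)) = inverse (det (D p))"
    by (metis D_inverse(1) det_I det_mul inverse_unique)
  then show ?thesis by (simp add: g_eq det_mul det_D exp_minus)
qed

lemma inverse_metric_Inl: "inverse_metric p $ Inl k $ s = (if s = Inl k then 1 else 0)"
proof -
  have "inverse_metric p $ Inl k $ s = D p $ s $ Inl k"
    by (simp add: inverse_metric_def matrix_matrix_mult_def transpose_def D_Inl axis_def
        if_distrib[of "\<lambda>x. x * _"] cong: if_cong)
  then show ?thesis
    by (cases s) (auto simp: D_Inl D_Inr_Inl axis_def)
qed

text \<open>The product rule separates the density from the gradient. The logarithmic derivative of
  the density lives in the \<open>t\<close>-directions only, where the components of the gradient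
  are the plain partial derivatives.\<close>

lemma laplace_beltrami_real_eq:
  assumes f: "\<And>p. (f has_derivative f' p) (at p)"
    and X: "\<And>i. ((\<lambda>q. \<Sum>j\<in>UNIV. inverse_metric q $ i $ j * f' q (axis j 1)) has_derivative X' i) (at p)"
  shows "laplace_beltrami_real g f p
    = (\<Sum>i\<in>UNIV. X' i (axis i 1)) - (\<Sum>k\<in>UNIV. w k * f' p (axis (Inl k) 1))"
proof -
  let ?l = "\<lambda>p::real^('m + 'l). \<Sum>k\<in>UNIV. w k * p $ Inl k"
  let ?X = "\<lambda>i q. \<Sum>j\<in>UNIV. inverse_metric q $ i $ j * f' q (axis j 1)"
  have grad: "riemannian_gradient g f q $ i = ?X i q" for q i
    by (simp add: riemannian_gradient_def matrix_inv_metric matrix_vector_mult_def partial_eq[OF f])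
  have l: "(?l has_derivative ?l) (at q)" for q
    by (intro has_derivative_sum has_derivative_mult_right
        bounded_linear_imp_has_derivative bounded_linear_vec_nth)
  have rho: "((\<lambda>q. exp (- ?l q)) has_derivative (\<lambda>h. exp (- ?l p) * - ?l h)) (at p)"
    using has_derivative_exp[OF has_derivative_minus[OF l[of p]]] by (simp add: mult.commute)
  have "partial i (\<lambda>q. exp (- ?l q) * ?X i q) p
      = exp (- ?l p) * (X' i (axis i 1) - ?l (axis i 1) * ?X i p)" for i
    by (subst partial_eq[OF has_derivative_mult[OF rho X]]) (simp add: algebra_simps)
  then have "laplace_beltrami_real g f p = (\<Sum>i\<in>UNIV. X' i (axis i 1) - ?l (axis i 1) * ?X i p)"
    by (simp add: laplace_beltrami_real_def riemannian_divergence_def sqrt_det_metric grad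
        flip: sum_distrib_left)
  moreover have "?l (axis (Inr i) 1) = 0" for i
    by (simp add: axis_def)
  moreover have "?l (axis (Inl k) 1) = w k" for k
    by (simp add: axis_def if_distrib[of "\<lambda>x. _ * x"] cong: if_cong)
  moreover have "?X (Inl k) p = f' p (axis (Inl k) 1)" for k
    by (simp add: inverse_metric_Inl if_distrib[of "\<lambda>x. x * _"] cong: if_cong)
  ultimately show ?thesis
    by (simp add: sum_subtractf sum_UNIV_Plus[of "\<lambda>i. ?l (axis i 1) * ?X i p"])
qed

lemma laplace_beltrami_eq:
  assumes f: "\<And>p. (f has_derivative f' p) (at p)"
    and X: "\<And>i. ((\<lambda>q. \<Sum>j\<in>UNIV. of_real (inverse_metric q $ i $ j) * f' q (axis j 1)) has_derivative X' i) (at p)"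
  shows "laplace_beltrami g f p
    = (\<Sum>i\<in>UNIV. X' i (axis i 1)) - (\<Sum>k\<in>UNIV. of_real (w k) * f' p (axis (Inl k) 1))"
proof -
  have "laplace_beltrami_real g (\<lambda>q. Re (f q)) p
      = (\<Sum>i\<in>UNIV. Re (X' i (axis i 1))) - (\<Sum>k\<in>UNIV. w k * Re (f' p (axis (Inl k) 1)))"
    using laplace_beltrami_real_eq[OF has_derivative_Re[OF f], of "\<lambda>i h. Re (X' i h)" p]
      has_derivative_Re[OF X] by simp
  moreover have "laplace_beltrami_real g (\<lambda>q. Im (f q)) p
      = (\<Sum>i\<in>UNIV. Im (X' i (axis i 1))) - (\<Sum>k\<in>UNIV. w k * Im (f' p (axis (Inl k) 1)))"
    using laplace_beltrami_real_eq[OF has_derivative_Im[OF f], of "\<lambda>i h. Im (X' i h)" p]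
      has_derivative_Im[OF X] by simp
  ultimately show ?thesis
    by (simp add: laplace_beltrami_def complex_eq_iff)
qed

text \<open>\<open>f1\<close> and \<open>f2\<close> are the first and second partial derivatives in
  \<open>t\<close>. No entry of the inverse metric couples \<open>t\<close> to the fibre, so the
  gradient is \<open>f1\<close> in the \<open>t\<close>-directions and mixed second derivatives
  never enter.\<close>

lemma laplace_beltrami_t:
  assumes f: "\<And>p. (f has_derivative (\<lambda>h. \<Sum>k\<in>UNIV. of_real (h $ Inl k) * f1 k p)) (at p)"
    and f1: "\<And>k. (f1 k has_derivative (\<lambda>h. \<Sum>j\<in>UNIV. of_real (h $ Inl j) * f2 k j)) (at p)"
  shows "laplace_beltrami g f p = (\<Sum>k\<in>UNIV. f2 k k - of_real (w k) * f1 k p)"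
proof -
  define f' where "f' = (\<lambda>p (h :: real^('m + 'l)). \<Sum>k\<in>UNIV. of_real (h $ Inl k) * f1 k p)"
  let ?X' = "\<lambda>i (h :: real^('m + 'l)). case i of Inl k \<Rightarrow> \<Sum>j\<in>UNIV. of_real (h $ Inl j) * f2 k j | Inr _ \<Rightarrow> 0"
  have f': "(f has_derivative f' q) (at q)" for q
    using f by (simp add: f'_def)
  have f'_Inl: "f' q (axis (Inl k) 1) = f1 k q" for q k
    unfolding f'_def by (rule sum_axis_mult)
  have f'_Inr: "f' q (axis (Inr i) 1) = 0" for q i
    by (simp add: axis_def f'_def)
  have sym: "inverse_metric q $ Inr i $ Inl k = 0" for q i k
    by (simp add: inverse_metric_def matrix_matrix_mult_def transpose_def D_Inl D_Inr_Inl axis_def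
        if_distrib[of "\<lambda>x. _ * x"] cong: if_cong)
  have "((\<lambda>q. \<Sum>j\<in>UNIV. of_real (inverse_metric q $ i $ j) * f' q (axis j 1)) has_derivative ?X' i) (at p)" for i
  proof (cases i)
    case [simp]: (Inl k)
    have "(\<Sum>j\<in>UNIV. of_real (inverse_metric q $ i $ j) * f' q (axis j 1)) = f1 k q" for q
      by (simp only: sum_UNIV_Plus f'_Inl f'_Inr inverse_metric_Inl)
         (simp add: inverse_metric_Inl if_distrib[of of_real] if_distrib[of "\<lambda>x. x * _"] cong: if_cong)
    with f1 show ?thesis by simp
  next
    case [simp]: (Inr i')
    have "(\<Sum>j\<in>UNIV. of_real (inverse_metric q $ i $ j) * f' q (axis j 1)) = 0" for q
      by (simp only: sum_UNIV_Plus f'_Inl f'_Inr) (simp add: sym)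
    then show ?thesis by simp
  qed
  from laplace_beltrami_eq[OF f' this] show ?thesis
    by (simp only: f'_Inl sum_UNIV_Plus)
       (simp add: axis_def sum_subtractf if_distrib[of of_real] if_distrib[of "\<lambda>x. x * _"] cong: if_cong)
qed

end

section \<open>Smooth functions\<close>

text \<open>Uniqueness of derivatives lets an explicit derivative stand in for
  \<open>frechet_derivative\<close>, so the closure properties below can use the usual derivative
  rules.\<close>

lemma times_cont_diff_SucI:
  assumes "\<And>p. (f has_derivative f' p) (at p)" and "\<And>v. times_cont_diff j (\<lambda>p. f' p v)"
  shows "times_cont_diff (Suc j) f"
proof -
  have "frechet_derivative f (at p) = f' p" for p
    using frechet_derivative_at[OF assms(1)] by simp
  with assms show ?thesis
    by (auto simp: differentiable_on_def differentiable_def intro: has_derivative_at_withinI)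
qed

lemma times_cont_diff_SucE:
  assumes "times_cont_diff (Suc j) f"
  obtains f' where "\<And>p. (f has_derivative f' p) (at p)" and "\<And>v. times_cont_diff j (\<lambda>p. f' p v)"
  using assms by (auto simp: differentiable_on_def intro: that[of "\<lambda>p. frechet_derivative f (at p)"]
      simp: frechet_derivative_works[symmetric])

lemma times_cont_diff_Suc_imp: "times_cont_diff (Suc j) f \<Longrightarrow> times_cont_diff j f"
proof (induction j arbitrary: f)
  case 0
  then show ?case by (simp add: differentiable_imp_continuous_on)
next
  case (Suc j)
  from Suc.prems obtain f' where f': "\<And>p. (f has_derivative f' p) (at p)"
    "\<And>v. times_cont_diff (Suc j) (\<lambda>p. f' p v)"
    by (rule times_cont_diff_SucE) blast
  from times_cont_diff_SucI[OF f'(1) Suc.IH[OF f'(2)]] show ?case .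
qed

lemma times_cont_diff_const: "times_cont_diff j (\<lambda>p. c)"
  by (induction j arbitrary: c) (auto intro!: times_cont_diff_SucI[OF has_derivative_const] simp del: times_cont_diff.simps(2))

lemma times_cont_diff_add:
  "times_cont_diff j f \<Longrightarrow> times_cont_diff j h \<Longrightarrow> times_cont_diff j (\<lambda>p. f p + h p)"
proof (induction j arbitrary: f h)
  case 0
  then show ?case by (simp add: continuous_on_add)
next
  case (Suc j)
  from Suc.prems(1) obtain f' where f': "\<And>p. (f has_derivative f' p) (at p)"
    "\<And>v. times_cont_diff j (\<lambda>p. f' p v)" by (rule times_cont_diff_SucE) blast
  from Suc.prems(2) obtain h' where h': "\<And>p. (h has_derivative h' p) (at p)"
    "\<And>v. times_cont_diff j (\<lambda>p. h' p v)" by (rule times_cont_diff_SucE) blast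
  show ?case
    by (rule times_cont_diff_SucI[OF has_derivative_add[OF f'(1) h'(1)] Suc.IH[OF f'(2) h'(2)]])
qed

lemma times_cont_diff_mult:
  fixes f h :: "'a::real_normed_vector \<Rightarrow> 'b::real_normed_algebra"
  shows "times_cont_diff j f \<Longrightarrow> times_cont_diff j h \<Longrightarrow> times_cont_diff j (\<lambda>p. f p * h p)"
proof (induction j arbitrary: f h)
  case 0
  then show ?case by (simp add: continuous_on_mult)
next
  case (Suc j)
  from Suc.prems(1) obtain f' where f': "\<And>p. (f has_derivative f' p) (at p)"
    "\<And>v. times_cont_diff j (\<lambda>p. f' p v)" by (rule times_cont_diff_SucE) blast
  from Suc.prems(2) obtain h' where h': "\<And>p. (h has_derivative h' p) (at p)"
    "\<And>v. times_cont_diff j (\<lambda>p. h' p v)" by (rule times_cont_diff_SucE) blast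
  \<comment> \<open>The induction hypothesis speaks of order \<open>j\<close>, so the
    undifferentiated factors are lowered from order \<open>Suc j\<close>.\<close>
  note fh = Suc.prems[THEN times_cont_diff_Suc_imp]
  show ?case
    by (rule times_cont_diff_SucI[OF has_derivative_mult[OF f'(1) h'(1)]
          times_cont_diff_add[OF Suc.IH[OF fh(1) h'(2)] Suc.IH[OF f'(2) fh(2)]]])
qed

lemma times_cont_diff_compose_linear:
  assumes "bounded_linear L"
  shows "times_cont_diff j f \<Longrightarrow> times_cont_diff j (\<lambda>p. f (L p))"
proof (induction j arbitrary: f)
  case 0
  then show ?case
    using continuous_on_compose2[of UNIV f UNIV L] linear_continuous_on[OF assms] by auto
next
  case (Suc j)
  from Suc.prems obtain f' where f': "\<And>p. (f has_derivative f' p) (at p)"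
    "\<And>v. times_cont_diff j (\<lambda>p. f' p v)" by (rule times_cont_diff_SucE) blast
  show ?case
    by (rule times_cont_diff_SucI[OF has_derivative_compose[OF bounded_linear_imp_has_derivative[OF assms] f'(1)]
          Suc.IH[OF f'(2)]])
qed

lemma smooth_const: "smooth (\<lambda>p. c)"
  by (simp add: smooth_def times_cont_diff_const)

lemma smooth_add: "smooth f \<Longrightarrow> smooth h \<Longrightarrow> smooth (\<lambda>p. f p + h p)"
  by (simp add: smooth_def times_cont_diff_add)

lemma smooth_mult:
  "smooth f \<Longrightarrow> smooth h \<Longrightarrow> smooth (\<lambda>p. f p * h p :: 'b::real_normed_algebra)"
  by (simp add: smooth_def times_cont_diff_mult)

lemma smooth_sum: "(\<And>i. i \<in> I \<Longrightarrow> smooth (f i)) \<Longrightarrow> smooth (\<lambda>p. \<Sum>i\<in>I. f i p)"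
  by (induction I rule: infinite_finite_induct) (simp_all add: smooth_const smooth_add)

lemma smooth_prod:
  "(\<And>i. i \<in> I \<Longrightarrow> smooth (f i)) \<Longrightarrow> smooth (\<lambda>p. \<Prod>i\<in>I. f i p :: 'b::{real_normed_algebra,comm_ring_1})"
  by (induction I rule: infinite_finite_induct) (simp_all add: smooth_const smooth_mult)

lemma smooth_compose_linear: "bounded_linear L \<Longrightarrow> smooth f \<Longrightarrow> smooth (\<lambda>p. f (L p))"
  by (simp add: smooth_def times_cont_diff_compose_linear)

lemma smooth_bounded_linear: "bounded_linear L \<Longrightarrow> smooth L"
  unfolding smooth_def
proof
  fix j assume L: "bounded_linear L"
  show "times_cont_diff j L"
  proof (cases j)
    case (Suc i)
    show ?thesis unfolding Suc
      by (rule times_cont_diff_SucI[OF bounded_linear_imp_has_derivative[OF L] times_cont_diff_const])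
  qed (simp add: linear_continuous_on L)
qed

lemma smooth_exp: "smooth (\<lambda>t. complex_of_real (exp (w * t)))"
  unfolding smooth_def
proof
  show "times_cont_diff j (\<lambda>t. complex_of_real (exp (w * t)))" for j
  proof (induction j)
    case 0
    show ?case by (auto intro!: continuous_intros)
  next
    case (Suc j)
    have "((\<lambda>t. complex_of_real (exp (w * t))) has_derivative
        (\<lambda>v. complex_of_real (w * v) * complex_of_real (exp (w * t)))) (at t)" for t
      by (auto intro!: derivative_eq_intros)
    then show ?case
      by (rule times_cont_diff_SucI) (intro times_cont_diff_mult times_cont_diff_const Suc)
  qed
qed

lemma smooth_power: "smooth (\<lambda>t. complex_of_real (t ^ n))"
  by (induction n)
     (simp_all add: smooth_const smooth_mult[OF smooth_bounded_linear[OF bounded_linear_of_real]])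

lemma smooth_phi: "smooth (phi c1 c2 w r)"
proof (cases "w = 0")
  case True
  show ?thesis
    unfolding phi_def using True
    by (simp del: of_real_power) (intro smooth_add smooth_mult smooth_const smooth_power)
next
  case False
  show ?thesis
    unfolding phi_def using False
    by (simp del: of_real_power) (intro smooth_add smooth_mult smooth_const smooth_power smooth_exp)
qed

section \<open>Products of functions of the separate coordinates\<close>

text \<open>Writing the derivative with the update \<open>G(k := G1 k)\<close> keeps it a sum of
  products of the same shape, so the lemma applies again for second derivatives.\<close>

lemma has_derivative_prod_components:
  fixes G G1 :: "'m::finite \<Rightarrow> real \<Rightarrow> complex"
  assumes "\<And>k t. (G k has_vector_derivative G1 k t) (at t)"
  shows "((\<lambda>p :: real^('m + 'l::finite). \<Prod>k\<in>UNIV. G k (p $ Inl k)) has_derivative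
    (\<lambda>h. \<Sum>k\<in>UNIV. of_real (h $ Inl k) * (\<Prod>j\<in>UNIV. (G(k := G1 k)) j (p $ Inl j)))) (at p)"
proof -
  have "((\<lambda>p :: real^('m + 'l). G k (p $ Inl k)) has_derivative (\<lambda>h. h $ Inl k *\<^sub>R G1 k (p $ Inl k))) (at p)" for k
    by (rule has_derivative_compose[OF bounded_linear_imp_has_derivative[OF bounded_linear_vec_nth]
          assms[unfolded has_vector_derivative_def]])
  then have "((\<lambda>p :: real^('m + 'l). \<Prod>k\<in>UNIV. G k (p $ Inl k)) has_derivative
    (\<lambda>h. \<Sum>k\<in>UNIV. (h $ Inl k *\<^sub>R G1 k (p $ Inl k)) * (\<Prod>j\<in>UNIV - {k}. G j (p $ Inl j)))) (at p)"
    by (rule has_derivative_prod)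
  moreover have "(\<Prod>j\<in>UNIV. (G(k := G1 k)) j (p $ Inl j))
      = G1 k (p $ Inl k) * (\<Prod>j\<in>UNIV - {k}. G j (p $ Inl j))" for k
    by (subst prod.remove[of _ k]) (auto intro!: prod.cong)
  ultimately show ?thesis
    by (simp add: scaleR_conv_of_real mult.assoc)
qed

section \<open>Words over the index set and their letter counts\<close>

text \<open>Splitting off the first letter is a bijection; this carries the expansion of the
  iterated Laplacian from \<open>n\<close> to \<open>n + 1\<close>.\<close>

lemma sum_lists_length_Suc:
  "(\<Sum>xs | length (xs :: 'm::finite list) = n. \<Sum>k\<in>UNIV. f (k # xs)) = (\<Sum>xs | length xs = Suc n. f xs)"
proof -
  have "{xs :: 'm list. length xs = Suc n} = (\<lambda>(xs, k). k # xs) ` ({xs. length xs = n} \<times> UNIV)"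
    by (auto simp: length_Suc_conv image_iff)
  moreover have "inj_on (\<lambda>(xs, k). k # xs) ({xs. length xs = n} \<times> (UNIV :: 'm set))"
    by (auto simp: inj_on_def)
  ultimately show ?thesis
    by (simp add: sum.reindex sum.cartesian_product case_prod_unfold)
qed

lemma finite_lists_length: "finite {xs :: 'm::finite list. length xs = n}"
  using finite_lists_length_eq[of "UNIV :: 'm set" n] by simp

lemma sum_count_list: "(\<Sum>k\<in>UNIV. count_list xs (k :: 'm::finite)) = length xs"
  by (rule sum_count_set) auto

text \<open>On a finite type every function to the naturals is the multiplicity function of a
  multiset, and every multiset comes from a list.\<close>

lemma exists_count_list:
  fixes a :: "'m::finite \<Rightarrow> nat"
  obtains xs where "count_list xs = a"
proof -
  obtain xs where "mset xs = Abs_multiset a" using ex_mset by blast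
  then have "count_list xs k = a k" for k
    by (simp add: Abs_multiset_inverse flip: count_mset)
  then show ?thesis using that by blast
qed

context left_invariant_frame
begin

text \<open>By \<open>step\<close>, \<open>F k i\<close> is the \<open>i\<close>-th iterate of the
  one-variable operator on the \<open>k\<close>-th factor; \<open>F1\<close> and \<open>F2\<close>
  are its derivatives. \<open>a x\<close> records the exponents of the summand \<open>x\<close>, and
  the Laplacian raises one exponent at a time, summed over the coordinates.\<close>

lemma laplace_beltrami_sum_prod:
  fixes F F1 F2 :: "'m \<Rightarrow> nat \<Rightarrow> real \<Rightarrow> complex"
  assumes d1: "\<And>k i t. (F k i has_vector_derivative F1 k i t) (at t)"
    and d2: "\<And>k i t. (F1 k i has_vector_derivative F2 k i t) (at t)"
    and step: "\<And>k i t. F k (Suc i) t = F2 k i t - of_real (w k) * F1 k i t"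
  shows "laplace_beltrami g (\<lambda>p. \<Sum>x\<in>W. \<Prod>k\<in>UNIV. F k (a x k) (p $ Inl k)) p
    = (\<Sum>x\<in>W. \<Sum>k\<in>UNIV. \<Prod>j\<in>UNIV. F j (((a x)(k := Suc (a x k))) j) (p $ Inl j))"
proof -
  define G where "G x k = F k (a x k)" for x k
  define G1 where "G1 x k = F1 k (a x k)" for x k
  define G2 where "G2 x k = F2 k (a x k)" for x k
  define f1 where "f1 k p = (\<Sum>x\<in>W. \<Prod>j\<in>UNIV. ((G x)(k := G1 x k)) j (p $ Inl j))"
    for k and p :: "real^('m + 'l)"
  \<comment> \<open>Differentiating twice in one coordinate replaces its factor by
    \<open>G2\<close>, in two different coordinates both factors by \<open>G1\<close>; the nested
    update covers both cases.\<close>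
  define f2 where "f2 k l = (\<Sum>x\<in>W. \<Prod>j\<in>UNIV.
    ((G x)(k := G1 x k, l := ((G1 x)(k := G2 x k)) l)) j (p $ Inl j))" for k l
  have dG: "(G x k has_vector_derivative G1 x k t) (at t)"
    "(G1 x k has_vector_derivative G2 x k t) (at t)" for x k t
    by (simp_all add: G_def G1_def G2_def d1 d2)
  have swap: "(\<Sum>x\<in>W. \<Sum>k\<in>UNIV. c k * P x k) = (\<Sum>k\<in>UNIV. c k * (\<Sum>x\<in>W. P x k))"
    for c :: "'m \<Rightarrow> complex" and P
    by (subst sum.swap) (simp add: sum_distrib_left)
  have "((\<lambda>p. \<Sum>x\<in>W. \<Prod>k\<in>UNIV. G x k (p $ Inl k)) has_derivative
      (\<lambda>h. \<Sum>k\<in>UNIV. of_real (h $ Inl k) * f1 k p)) (at p)" for p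
    unfolding f1_def swap[symmetric]
    by (rule has_derivative_sum, rule has_derivative_prod_components, rule dG)
  moreover have "(f1 k has_derivative (\<lambda>h. \<Sum>l\<in>UNIV. of_real (h $ Inl l) * f2 k l)) (at p)" for k
    unfolding f1_def[abs_def] f2_def swap[symmetric]
    by (rule has_derivative_sum, rule has_derivative_prod_components) (simp add: dG)
  ultimately have "laplace_beltrami g (\<lambda>p. \<Sum>x\<in>W. \<Prod>k\<in>UNIV. G x k (p $ Inl k)) p
      = (\<Sum>k\<in>UNIV. f2 k k - of_real (w k) * f1 k p)"
    by (rule laplace_beltrami_t)
  also have "\<dots> = (\<Sum>k\<in>UNIV. \<Sum>x\<in>W. \<Prod>j\<in>UNIV. F j (((a x)(k := Suc (a x k))) j) (p $ Inl j))"
  proof (rule sum.cong[OF refl])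
    fix k
    have split: "(\<Prod>j\<in>UNIV. (H(k := h)) j (p $ Inl j))
        = h (p $ Inl k) * (\<Prod>j\<in>UNIV - {k}. H j (p $ Inl j))" for H :: "'m \<Rightarrow> real \<Rightarrow> complex" and h
      by (subst prod.remove[of _ k]) (auto intro!: prod.cong)
    have "F j (((a x)(k := Suc (a x k))) j) = ((G x)(k := F k (Suc (a x k)))) j" for x j
      by (simp add: G_def)
    then show "f2 k k - of_real (w k) * f1 k p
        = (\<Sum>x\<in>W. \<Prod>j\<in>UNIV. F j (((a x)(k := Suc (a x k))) j) (p $ Inl j))"
      unfolding f1_def f2_def
      by (simp only: fun_upd_upd fun_upd_same split step)
         (simp add: G1_def G2_def sum_distrib_left sum_subtractf algebra_simps)
  qed
  finally show ?thesis
    by (subst sum.swap) (simp add: G_def)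
qed

text \<open>The iterates of the Laplacian on a product of functions of the separate \<open>t\<^sub>k\<close> are indexed by words
  over the index set; the letter \<open>k\<close> stands for one application of the \<open>k\<close>-th summand of the operator.\<close>

lemma laplace_beltrami_power_prod:
  fixes F F1 F2 :: "'m \<Rightarrow> nat \<Rightarrow> real \<Rightarrow> complex"
  assumes d1: "\<And>k i t. (F k i has_vector_derivative F1 k i t) (at t)"
    and d2: "\<And>k i t. (F1 k i has_vector_derivative F2 k i t) (at t)"
    and step: "\<And>k i t. F k (Suc i) t = F2 k i t - of_real (w k) * F1 k i t"
  shows "(laplace_beltrami g ^^ n) (\<lambda>p. \<Prod>k\<in>UNIV. F k 0 (p $ Inl k))
    = (\<lambda>p. \<Sum>xs | length xs = n. \<Prod>k\<in>UNIV. F k (count_list xs k) (p $ Inl k))"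
proof (induction n)
  case (Suc n)
  have "(count_list xs)(k := Suc (count_list xs k)) = count_list (k # xs)" for xs and k :: 'm
    by auto
  then show ?case
    by (simp add: Suc fun_eq_iff laplace_beltrami_sum_prod[where F = F and ?F1.0 = F1 and ?F2.0 = F2, OF d1 d2 step]
        sum_lists_length_Suc[of "\<lambda>xs. \<Prod>j\<in>UNIV. F j (count_list xs j) (_ $ Inl j)"] del: count_list.simps fun_upd_apply)
qed simp

text \<open>A word of length at least \<open>n\<close> whose counts are not exactly
  \<open>r k - 1\<close> has a letter \<open>k\<close> occurring at least \<open>r k\<close> times,
  which kills its product. The words with exactly these counts have length \<open>n\<close> and all
  give the same product.\<close>

lemma proper_harmonic_prod:
  fixes F F1 F2 :: "'m \<Rightarrow> nat \<Rightarrow> real \<Rightarrow> complex"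
  assumes d1: "\<And>k i t. (F k i has_vector_derivative F1 k i t) (at t)"
    and d2: "\<And>k i t. (F1 k i has_vector_derivative F2 k i t) (at t)"
    and step: "\<And>k i t. F k (Suc i) t = F2 k i t - of_real (w k) * F1 k i t"
    and r: "\<And>k. r k \<ge> 1"
    and zero: "\<And>k i t. i \<ge> r k \<Longrightarrow> F k i t = 0"
    and nonzero: "\<And>k. \<exists>t. F k (r k - 1) t \<noteq> 0"
    and smooth: "\<And>k. smooth (F k 0)"
  shows "proper_harmonic g ((\<Sum>k\<in>UNIV. r k) - CARD('m) + 1) (\<lambda>p. \<Prod>k\<in>UNIV. F k 0 (p $ Inl k))"
proof -
  define n where "n = (\<Sum>k\<in>UNIV. r k - 1)"
  \<comment> \<open>Every \<open>r k\<close> is positive, so the truncated subtraction of naturals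
    is exact.\<close>
  have n: "(\<Sum>k\<in>UNIV. r k) - CARD('m) = n"
    unfolding n_def by (subst sum_subtractf_nat) (use r in auto)
  obtain T where T: "\<And>k. F k (r k - 1) (T k) \<noteq> 0" using nonzero by metis
  define P where "P xs p = (\<Prod>k\<in>UNIV. F k (count_list xs k) (p $ Inl k))" for xs and p :: "real^('m + 'l)"
  have P: "P xs p = 0" if "n \<le> length xs" "count_list xs \<noteq> (\<lambda>k. r k - 1)" for xs p
  proof -
    have "\<exists>k. r k \<le> count_list xs k"
    proof (rule ccontr)
      assume "\<not> ?thesis"
      then have le: "count_list xs k \<le> r k - 1" for k
        by (metis One_nat_def Suc_pred not_less_eq_eq r less_eq_Suc_le not_le)
      then have "(\<Sum>k\<in>UNIV. count_list xs k) < n"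
        unfolding n_def using that(2) by (intro sum_strict_mono_ex1) (auto simp: fun_eq_iff le order.strict_iff_order)
      with that(1) show False by (simp add: sum_count_list)
    qed
    then show ?thesis unfolding P_def using zero by (intro prod_zero) auto
  qed
  have LB: "(laplace_beltrami g ^^ i) (\<lambda>p. \<Prod>k\<in>UNIV. F k 0 (p $ Inl k)) p = (\<Sum>xs | length xs = i. P xs p)" for i p
    by (simp add: laplace_beltrami_power_prod[where F = F and ?F1.0 = F1 and ?F2.0 = F2, OF d1 d2 step] P_def)
  have 1: "(laplace_beltrami g ^^ Suc n) (\<lambda>p. \<Prod>k\<in>UNIV. F k 0 (p $ Inl k)) p = 0" for p
  proof -
    have "P xs p = 0" if "length xs = Suc n" for xs
    proof (rule P)
      show "count_list xs \<noteq> (\<lambda>k. r k - 1)"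
        using that sum_count_list[of xs] by (auto simp: n_def)
    qed (use that in simp)
    then show ?thesis unfolding LB by (intro sum.neutral) simp
  qed
  \<comment> \<open>A point where every top iterate is non-zero; the fibre coordinates do not enter
    and are set to 0.\<close>
  define p where "p = ((\<chi> s. case s of Inl k \<Rightarrow> T k | Inr _ \<Rightarrow> 0) :: real^('m + 'l))"
  define c where "c = (\<Prod>k\<in>UNIV. F k (r k - 1) (T k))"
  \<comment> \<open>\<open>card X\<close> is a multinomial coefficient; only its being non-zero
    matters.\<close>
  define X where "X = {xs :: 'm list. length xs = n \<and> count_list xs = (\<lambda>k. r k - 1)}"
  have "(\<Sum>xs | length xs = n. P xs p) = (\<Sum>xs\<in>X. P xs p)"
    unfolding X_def by (intro sum.mono_neutral_right finite_lists_length) (auto intro: P)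
  also have "\<dots> = (\<Sum>xs\<in>X. c)"
    by (intro sum.cong) (auto simp: X_def P_def c_def p_def)
  finally have 2: "(laplace_beltrami g ^^ n) (\<lambda>p. \<Prod>k\<in>UNIV. F k 0 (p $ Inl k)) p = of_nat (card X) * c"
    unfolding LB by simp
  obtain xs where "count_list xs = (\<lambda>k. r k - 1)" by (rule exists_count_list)
  moreover from this have "length xs = n" using sum_count_list[of xs] by (simp add: n_def)
  ultimately have "xs \<in> X" by (simp add: X_def)
  moreover have "finite X" unfolding X_def by (rule finite_subset[OF _ finite_lists_length[of n]]) auto
  ultimately have "card X \<noteq> 0" by auto
  moreover have "c \<noteq> 0" using T by (simp add: c_def)
  moreover have "smooth (\<lambda>p :: real^('m + 'l). \<Prod>k\<in>UNIV. F k 0 (p $ Inl k))"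
    by (intro smooth_prod smooth_compose_linear[OF bounded_linear_vec_nth] smooth)
  ultimately show ?thesis
    unfolding proper_harmonic_def n using 1 2 by (auto intro!: exI[of _ p])
qed

end

section \<open>Nilpotency of the one-variable operators\<close>

text \<open>The operator \<open>\<partial>\<^sup>2 - w \<partial>\<close> maps \<open>P e\<^bsup>wt\<^esup> + Q\<close> to \<open>(P'' + w P') e\<^bsup>wt\<^esup> + (Q'' - w Q')\<close>.\<close>

definition drift_op :: "complex \<Rightarrow> complex poly \<Rightarrow> complex poly" where
  "drift_op v P = pderiv (pderiv P) + smult v (pderiv P)"

lemma coeff_drift_op:
  "coeff (drift_op v P) d = of_nat (Suc d) * (of_nat (Suc (Suc d)) * coeff P (Suc (Suc d)) + v * coeff P (Suc d))"
  by (simp add: drift_op_def coeff_pderiv algebra_simps)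

lemma drift_op_0 [simp]: "drift_op v 0 = 0"
  by (simp add: drift_op_def)

lemma drift_op_power_0 [simp]: "(drift_op v ^^ i) 0 = 0"
  by (induction i) auto

text \<open>Each application lowers the degree bound by one and multiplies the top coefficient by a
  non-zero multiple of \<open>v\<close>.\<close>

lemma drift_op_power_const:
  assumes "degree P \<le> n" and "v \<noteq> 0"
  shows "\<exists>c. (drift_op v ^^ n) P = [:c:] \<and> (c = 0 \<longleftrightarrow> coeff P n = 0)"
  using assms(1)
proof (induction n arbitrary: P)
  case 0
  then obtain c where "P = [:c:]" by (auto elim: degree_eq_zeroE)
  then show ?case by simp
next
  case (Suc n)
  have "coeff (drift_op v P) d = 0" if "d > n" for d
    using that Suc.prems by (simp add: coeff_drift_op coeff_eq_0)
  then have "degree (drift_op v P) \<le> n" by (simp add: degree_le)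
  moreover have "coeff (drift_op v P) n = of_nat (Suc n) * v * coeff P (Suc n)"
    using Suc.prems by (simp add: coeff_drift_op coeff_eq_0)
  ultimately show ?case
    using Suc.IH[of "drift_op v P"] assms(2) by (simp add: funpow_Suc_right del: funpow.simps of_nat_Suc)
qed

text \<open>Here the operator is the second derivative: it lowers the degree bound by two and
  multiplies the two top coefficients by non-zero integers.\<close>

lemma drift_op_0_power_linear:
  assumes "degree P \<le> 2 * n + 1"
  shows "degree ((drift_op 0 ^^ n) P) \<le> 1 \<and>
    (coeff P (2 * n + 1) \<noteq> 0 \<or> coeff P (2 * n) \<noteq> 0 \<longrightarrow> (drift_op 0 ^^ n) P \<noteq> 0)"
  using assms
proof (induction n arbitrary: P)
  case (Suc n)
  have "coeff (drift_op 0 P) d = 0" if "d > 2 * n + 1" for d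
    using that Suc.prems by (simp add: coeff_drift_op coeff_eq_0)
  then have "degree (drift_op 0 P) \<le> 2 * n + 1" by (simp add: degree_le)
  then show ?case
    using Suc.IH[of "drift_op 0 P"]
    by (simp add: funpow_Suc_right coeff_drift_op del: funpow.simps of_nat_Suc)
qed auto

section \<open>Exponential polynomials\<close>

definition exp_poly :: "real \<Rightarrow> complex poly \<Rightarrow> complex poly \<Rightarrow> real \<Rightarrow> complex" where
  "exp_poly w P Q t = poly P (of_real t) * of_real (exp (w * t)) + poly Q (of_real t)"

text \<open>Functions of this form are closed under differentiation: \<open>P\<close> times the
  exponential acquires the new coefficient \<open>P' + w P\<close>.\<close>

lemma has_vector_derivative_exp_poly:
  "(exp_poly w P Q has_vector_derivative exp_poly w (pderiv P + smult (of_real w) P) (pderiv Q) t) (at t)"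
proof -
  have p: "((\<lambda>t. poly R (complex_of_real t)) has_vector_derivative poly (pderiv R) (of_real t)) (at t)" for R
    using has_vector_derivative_real_field[OF poly_DERIV[of R "of_real t"]] by simp
  have e: "((\<lambda>t. complex_of_real (exp (w * t))) has_vector_derivative of_real (w * exp (w * t))) (at t)"
    by (rule has_vector_derivative_of_real) (auto intro!: derivative_eq_intros)
  show ?thesis
    unfolding exp_poly_def[abs_def]
    by (rule has_vector_derivative_eq_rhs[OF has_vector_derivative_add[OF has_vector_derivative_mult[OF p e] p]])
       (simp add: algebra_simps)
qed

text \<open>\<open>F\<close> is the sequence of iterates of the second derivative minus
  \<open>w\<close> times the first, starting at \<open>f\<close>. Carrying the derivatives
  \<open>F1\<close> and \<open>F2\<close> as witnesses avoids an operator defined on all functions.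
  The order \<open>r\<close> of nilpotency is exact.\<close>

definition drift_nilpotent :: "real \<Rightarrow> nat \<Rightarrow> (real \<Rightarrow> complex) \<Rightarrow> bool" where
  "drift_nilpotent w r f \<longleftrightarrow> (\<exists>F F1 F2. F 0 = f \<and>
     (\<forall>i t. (F i has_vector_derivative F1 i t) (at t)) \<and>
     (\<forall>i t. (F1 i has_vector_derivative F2 i t) (at t)) \<and>
     (\<forall>i t. F (Suc i) t = F2 i t - of_real w * F1 i t) \<and>
     (\<forall>i t. i \<ge> r \<longrightarrow> F i t = 0) \<and> (\<exists>t. F (r - 1) t \<noteq> 0))"

text \<open>For \<open>w\<close> non-zero the last iterate is a non-zero combination of the
  exponential and 1, for \<open>w = 0\<close> a non-zero polynomial of degree at most 1.\<close>

lemma drift_nilpotent_phi: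
  assumes r: "r \<ge> 1" and c: "(c1, c2) \<noteq> (0, 0)"
  shows "drift_nilpotent w r (phi c1 c2 w r)"
proof -
  obtain n where n: "r = Suc n" using r by (cases r) auto
  \<comment> \<open>For \<open>w = 0\<close> the exponential factor is 1, so the whole function is
    put into \<open>Q\<close>.\<close>
  define P where "P = (if w = 0 then 0 else monom c1 n)"
  define Q where "Q = (if w = 0 then monom c1 (2 * n + 1) + monom c2 (2 * n) else monom c2 n)"
  define Pi where "Pi i = (drift_op (of_real w) ^^ i) P" for i
  define Qi where "Qi i = (drift_op (- of_real w) ^^ i) Q" for i
  define d where "d = (\<lambda>P. pderiv P + smult (complex_of_real w) P)"
  define F where "F i = exp_poly w (Pi i) (Qi i)" for i
  define F1 where "F1 i = exp_poly w (d (Pi i)) (pderiv (Qi i))" for i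
  define F2 where "F2 i = exp_poly w (d (d (Pi i))) (pderiv (pderiv (Qi i)))" for i
  have "F 0 = phi c1 c2 w r"
    by (auto simp: fun_eq_iff F_def Pi_def Qi_def P_def Q_def n phi_def exp_poly_def poly_monom)
  moreover have "(F i has_vector_derivative F1 i t) (at t)" "(F1 i has_vector_derivative F2 i t) (at t)" for i t
    unfolding F_def F1_def F2_def d_def by (rule has_vector_derivative_exp_poly)+
  moreover have "F (Suc i) t = F2 i t - of_real w * F1 i t" for i t
    by (simp add: F_def F1_def F2_def Pi_def Qi_def exp_poly_def drift_op_def d_def
        pderiv_add pderiv_smult algebra_simps)
  moreover have "F i t = 0" if "i \<ge> r" for i t
  proof -
    \<comment> \<open>It suffices that the power \<open>n + 1\<close> vanishes, because
      \<open>i\<close> is at least \<open>r = n + 1\<close> and 0 is mapped to 0.\<close>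
    have kill: "(drift_op v ^^ i) R = 0" if "drift_op v ((drift_op v ^^ n) R) = 0" for v R
    proof -
      obtain j where "i = j + Suc n" using \<open>i \<ge> r\<close> n by (metis add.commute le_Suc_ex)
      then show ?thesis
        by (simp only: funpow_add funpow.simps(2) o_apply that drift_op_power_0)
    qed
    have const: "drift_op v ((drift_op v ^^ n) R) = 0" if "degree R \<le> n" "v \<noteq> 0" for v R
      using drift_op_power_const[OF that] by (auto simp: drift_op_def pderiv_pCons)
    have "Pi i = 0 \<and> Qi i = 0"
    proof (cases "w = 0")
      case True
      have "degree Q \<le> 2 * n + 1"
        by (simp add: Q_def True degree_add_le degree_monom_le order.trans[OF degree_monom_le])
      then have deg: "degree ((drift_op 0 ^^ n) Q) \<le> 1" using drift_op_0_power_linear by blast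
      have "drift_op 0 ((drift_op 0 ^^ n) Q) = 0"
        by (rule poly_eqI) (use deg in \<open>simp add: coeff_drift_op coeff_eq_0\<close>)
      from kill[OF this] show ?thesis
        by (simp add: Pi_def Qi_def P_def True)
    next
      case False
      then show ?thesis
        unfolding Pi_def Qi_def by (auto intro!: kill const simp: P_def Q_def degree_monom_le)
    qed
    then show ?thesis by (simp add: F_def exp_poly_def)
  qed
  moreover have "\<exists>t. F (r - 1) t \<noteq> 0"
  proof (cases "w = 0")
    case True
    have "degree Q \<le> 2 * n + 1"
      by (simp add: Q_def True degree_add_le degree_monom_le order.trans[OF degree_monom_le])
    moreover have "coeff Q (2 * n + 1) \<noteq> 0 \<or> coeff Q (2 * n) \<noteq> 0"
      using c by (auto simp: Q_def True)
    ultimately have "Qi n \<noteq> 0"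
      using drift_op_0_power_linear[of Q n] by (simp add: Qi_def True)
    \<comment> \<open>A non-zero polynomial has finitely many roots, so some real number is not a
      root.\<close>
    then have "finite {z. poly (Qi n) z = 0}" by (rule poly_roots_finite)
    moreover have "infinite (range complex_of_real)"
      using infinite_UNIV_char_0 finite_imageD[OF _ inj_of_real] by blast
    ultimately obtain t where "poly (Qi n) (complex_of_real t) \<noteq> 0"
      by (metis (mono_tags, lifting) finite_subset image_subset_iff mem_Collect_eq)
    then show ?thesis
      by (auto simp: F_def n exp_poly_def Pi_def P_def True)
  next
    case False
    obtain a where a: "Pi n = [:a:]" "a = 0 \<longleftrightarrow> c1 = 0"
      using drift_op_power_const[of P n "of_real w"] False by (auto simp: P_def Pi_def degree_monom_le)
    obtain b where b: "Qi n = [:b:]" "b = 0 \<longleftrightarrow> c2 = 0"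
      using drift_op_power_const[of Q n "- of_real w"] False by (auto simp: Q_def Qi_def degree_monom_le)
    have F: "F (r - 1) t = a * of_real (exp (w * t)) + b" for t
      by (simp add: F_def n exp_poly_def a b)
    show ?thesis
    proof (rule ccontr)
      assume "\<not> ?thesis"
      \<comment> \<open>The points 0 and 1 separate the exponential from the constant, because
        \<open>exp w\<close> differs from 1.\<close>
      then have "F (r - 1) 0 = 0" "F (r - 1) 1 = 0" by blast+
      then have ab: "a + b = 0" "a * of_real (exp w) + b = 0" unfolding F by simp_all
      have "a * (of_real (exp w) - 1) = (a * of_real (exp w) + b) - (a + b)"
        by (simp add: algebra_simps)
      then have "a * (of_real (exp w) - 1) = 0" by (simp only: ab diff_self)
      moreover have "complex_of_real (exp w) \<noteq> 1" using False by (simp only: of_real_eq_1_iff exp_eq_one_iff not_False_eq_True)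
      ultimately have "a = 0" by simp
      with ab a b c show False by simp
    qed
  qed
  ultimately show ?thesis unfolding drift_nilpotent_def by blast
qed

text \<open>The constant factor, which allows a function of one coordinate to be treated as a
  product over all coordinates.\<close>

lemma drift_nilpotent_1: "drift_nilpotent w 1 (\<lambda>t. 1)"
  unfolding drift_nilpotent_def
  by (rule exI[of _ "\<lambda>i t. if i = 0 then 1 else 0"], rule exI[of _ "\<lambda>_ _. 0"], rule exI[of _ "\<lambda>_ _. 0"]) auto

context left_invariant_frame
begin

lemma proper_harmonic_prod_nilpotent:
  assumes nil: "\<And>k. drift_nilpotent (w k) (r k) (f k)"
    and r: "\<And>k. r k \<ge> 1" and smooth: "\<And>k. smooth (f k)"
  shows "proper_harmonic g ((\<Sum>k\<in>UNIV. r k) - CARD('m) + 1) (\<lambda>p. \<Prod>k\<in>UNIV. f k (p $ Inl k))"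
proof -
  from nil obtain F F1 F2 where F: "\<And>k. F k 0 = f k"
      "\<And>k i t. (F k i has_vector_derivative F1 k i t) (at t)"
      "\<And>k i t. (F1 k i has_vector_derivative F2 k i t) (at t)"
      "\<And>k i t. F k (Suc i) t = F2 k i t - of_real (w k) * F1 k i t"
      "\<And>k i t. i \<ge> r k \<Longrightarrow> F k i t = 0" "\<And>k. \<exists>t. F k (r k - 1) t \<noteq> 0"
    unfolding drift_nilpotent_def by metis
  from proper_harmonic_prod[where F = F and ?F1.0 = F1 and ?F2.0 = F2, OF F(2-4) r F(5,6)]
  show ?thesis by (simp add: F(1) smooth)
qed

lemma proper_harmonic_prod_phi:
  assumes "\<And>k. r k \<ge> 1" and "(c1, c2) \<noteq> (0, 0)"
  shows "proper_harmonic g ((\<Sum>k\<in>UNIV. r k) - CARD('m) + 1)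
    (\<lambda>p. \<Prod>k\<in>UNIV. phi c1 c2 (w k) (r k) (p $ Inl k))"
  by (intro proper_harmonic_prod_nilpotent drift_nilpotent_phi smooth_phi assms)

text \<open>All other factors are 1 and have order 1, so with \<open>m\<close> coordinates the order
  of the product is \<open>(r + (m - 1)) - m + 1 = r\<close>.\<close>

lemma proper_harmonic_phi:
  assumes r: "r \<ge> 1" and c: "(c1, c2) \<noteq> (0, 0)"
  shows "proper_harmonic g r (\<lambda>p. phi c1 c2 (w k) r (p $ Inl k))"
proof -
  define s where "s j = (if j = k then r else 1)" for j
  define f where "f j = (if j = k then phi c1 c2 (w k) r else (\<lambda>t. 1))" for j
  have "proper_harmonic g ((\<Sum>j\<in>UNIV. s j) - CARD('m) + 1) (\<lambda>p. \<Prod>j\<in>UNIV. f j (p $ Inl j))"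
    by (rule proper_harmonic_prod_nilpotent)
      (use r in \<open>simp_all add: s_def f_def smooth_phi smooth_const drift_nilpotent_phi[OF r c] drift_nilpotent_1[simplified]\<close>)
  moreover have "(\<Sum>j\<in>UNIV. s j) - CARD('m) + 1 = r"
  proof -
    have "(\<Sum>j\<in>UNIV. s j) = r + (CARD('m) - 1)"
      by (simp add: sum.remove[of UNIV k] s_def card_Diff_subset)
    moreover have "CARD('m) > 0" by simp
    ultimately show ?thesis using r by linarith
  qed
  moreover have "(\<Prod>j\<in>UNIV. f j (p $ Inl j)) = phi c1 c2 (w k) r (p $ Inl k)" for p :: "real^('m + 'l)"
    by (simp add: f_def prod.remove[of UNIV k])
  ultimately show ?thesis by simp
qed

end

section \<open>Quadratic functions\<close>

text \<open>The differential of a quadratic form: by symmetry of \<open>C\<close> both halves of the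
  product rule agree after exchanging the indices.\<close>

lemma sum_sum_symmetric:
  fixes C :: "'l::finite \<Rightarrow> 'l \<Rightarrow> complex"
  assumes "\<And>l m. C l m = C m l"
  shows "(\<Sum>l\<in>UNIV. \<Sum>m\<in>UNIV. C l m * (x l * y m + y l * x m)) = (\<Sum>m\<in>UNIV. y m * (2 * (\<Sum>l\<in>UNIV. C m l * x l)))"
proof -
  have "(\<Sum>l\<in>UNIV. \<Sum>m\<in>UNIV. C l m * (x l * y m)) = (\<Sum>m\<in>UNIV. \<Sum>l\<in>UNIV. C m l * (x l * y m))"
    by (subst sum.swap) (simp add: assms)
  then show ?thesis
    by (simp add: distrib_left sum.distrib sum_distrib_left mult_ac)
qed

text \<open>The values at 0, at plus and minus a unit vector, and at a sum of two unit vectors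
  determine all coefficients. This shows that the quadratic functions do not vanish
  identically.\<close>

lemma quadratic_function_eq_0:
  fixes a :: complex and V :: "'l::finite \<Rightarrow> complex"
  assumes sym: "\<And>l m. C l m = C m l"
    and zero: "\<And>y :: 'l \<Rightarrow> real. a + (\<Sum>l\<in>UNIV. V l * of_real (y l))
        + (\<Sum>l\<in>UNIV. \<Sum>m\<in>UNIV. C l m * of_real (y l) * of_real (y m)) = 0"
  shows "a = 0" and "V l = 0" and "C l m = 0"
proof -
  have lin: "(\<Sum>i\<in>UNIV. u i * of_real (s * of_bool (i = l) + t * of_bool (i = m))) = of_real s * u l + of_real t * u m"
    for u :: "'l \<Rightarrow> complex" and s t l m
    by (simp add: distrib_left sum.distrib mult_ac of_bool_def if_distrib[of of_real] if_distrib[of "\<lambda>x. _ * x"] cong: if_cong)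
  have ev: "a + (of_real s * V l + of_real t * V m) + (of_real s * (of_real s * C l l + of_real t * C l m)
      + of_real t * (of_real s * C m l + of_real t * C m m)) = 0" for s t l m
  proof -
    let ?y = "\<lambda>i. s * of_bool (i = l) + t * of_bool (i = m)"
    have "(\<Sum>i\<in>UNIV. \<Sum>j\<in>UNIV. C i j * z i * z j) = (\<Sum>i\<in>UNIV. (\<Sum>j\<in>UNIV. C i j * z j) * z i)" for z
      by (simp add: sum_distrib_left mult_ac)
    from zero[of ?y, unfolded this] show ?thesis by (simp only: lin)
  qed
  show a: "a = 0" using ev[of 0 l 0 l] by simp
  have VC: "V i = 0 \<and> C i i = 0" for i
  proof -
    have plus: "V i + C i i = 0" and minus: "- V i + C i i = 0"
      using ev[of 1 i 0 i] ev[of "-1" i 0 i] a by simp_all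
    have "2 * C i i = (V i + C i i) + (- V i + C i i)" by simp
    then have "C i i = 0" by (simp only: plus minus) simp
    with plus show ?thesis by simp
  qed
  then show "V l = 0" by simp
  have "C l m + C m l = 0" using ev[of 1 l 1 m] a VC by simp
  then show "C l m = 0" using sym[of l m] by simp
qed

context left_invariant_frame
begin

lemma inverse_metric_differentiable:
  "(\<lambda>q. inverse_metric q $ i $ j) differentiable at p"
proof -
  have "D differentiable at p" using D_deriv differentiable_def by blast
  then have "(\<lambda>q. D q $ i $ j) differentiable at p" for i j
    by (intro differentiable_compose[OF bounded_linear_imp_differentiable[OF bounded_linear_vec_nth], where g = "\<lambda>q. D q $ i" for i]
        differentiable_compose[OF bounded_linear_imp_differentiable[OF bounded_linear_vec_nth], where g = D])
  then show ?thesis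
    by (simp add: inverse_metric_def matrix_matrix_mult_def transpose_def differentiable_sum)
qed

text \<open>By \<open>d\<close>, the entries in row \<open>l\<close> of the inverse metric are
  affine in the \<open>l\<close>-th fibre coordinate, with slope \<open>d p l m\<close>. The sum in
  \<open>zero\<close> is then the Laplacian, with \<open>V + 2 C x\<close> the partial derivatives
  and \<open>2 C\<close> the Hessian. The drift term vanishes as the function does not involve
  \<open>t\<close>.\<close>

lemma proper_harmonic_quadratic:
  fixes a :: complex and V :: "'l \<Rightarrow> complex" and C :: "'l \<Rightarrow> 'l \<Rightarrow> complex"
  assumes sym: "\<And>l m. C l m = C m l"
    and nontrivial: "a \<noteq> 0 \<or> (\<exists>l. V l \<noteq> 0) \<or> (\<exists>l m. C l m \<noteq> 0)"
    and d: "\<And>p l m s. inverse_metric (p + s *\<^sub>R axis (Inr l) 1) $ Inr l $ Inr m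
        = inverse_metric p $ Inr l $ Inr m + s * d p l m"
    and zero: "\<And>p. (\<Sum>l\<in>UNIV. \<Sum>m\<in>UNIV.
        of_real (d p l m) * (V m + 2 * (\<Sum>n\<in>UNIV. C m n * of_real (p $ Inr n)))
          + 2 * of_real (inverse_metric p $ Inr l $ Inr m) * C l m) = 0"
  shows "proper_harmonic g 1 (\<lambda>p. a + (\<Sum>l\<in>UNIV. V l * of_real (p $ Inr l))
    + (\<Sum>l\<in>UNIV. \<Sum>m\<in>UNIV. C l m * of_real (p $ Inr l) * of_real (p $ Inr m)))"
    (is "proper_harmonic g 1 ?f")
proof -
  define G where "G m p = V m + 2 * (\<Sum>n\<in>UNIV. C m n * of_real (p $ Inr n))"
    for m and p :: "real^('m + 'l)"
  define f' where "f' p h = (\<Sum>m\<in>UNIV. of_real (h $ Inr m) * G m p)" for p h :: "real^('m + 'l)"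
  have entry: "((\<lambda>p. complex_of_real (p $ s)) has_derivative (\<lambda>h. of_real (h $ s))) (at p)"
    for s and p :: "real^('m + 'l)"
    by (intro has_derivative_of_real bounded_linear_imp_has_derivative bounded_linear_vec_nth)
  have f: "(?f has_derivative f' p) (at p)" for p
  proof -
    have "(?f has_derivative (\<lambda>h. 0 + (\<Sum>l\<in>UNIV. V l * of_real (h $ Inr l))
        + (\<Sum>l\<in>UNIV. \<Sum>m\<in>UNIV. C l m * of_real (p $ Inr l) * of_real (h $ Inr m)
            + C l m * of_real (h $ Inr l) * of_real (p $ Inr m)))) (at p)"
      by (intro has_derivative_add has_derivative_const has_derivative_sum has_derivative_mult has_derivative_mult_right entry)
    moreover have "0 + (\<Sum>l\<in>UNIV. V l * of_real (h $ Inr l))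
        + (\<Sum>l\<in>UNIV. \<Sum>m\<in>UNIV. C l m * of_real (p $ Inr l) * of_real (h $ Inr m)
            + C l m * of_real (h $ Inr l) * of_real (p $ Inr m)) = f' p h" for h
      using sum_sum_symmetric[of C "\<lambda>l. of_real (p $ Inr l)" "\<lambda>l. of_real (h $ Inr l)", OF sym]
      by (simp add: f'_def G_def distrib_left sum.distrib mult_ac)
    ultimately show ?thesis by simp
  qed
  have f'_Inl: "f' q (axis (Inl k) 1) = 0" for q k
    by (simp add: f'_def axis_def)
  have f'_Inr: "f' q (axis (Inr m) 1) = G m q" for q m
    by (simp add: f'_def axis_def if_distrib[of of_real] if_distrib[of "\<lambda>x. x * _"] cong: if_cong)
  have LB: "laplace_beltrami g ?f p = 0" for p
  proof -
    define H' where "H' i j = frechet_derivative (\<lambda>q. inverse_metric q $ i $ j) (at p)" for i j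
    have H': "((\<lambda>q. inverse_metric q $ i $ j) has_derivative H' i j) (at p)" for i j
      unfolding H'_def using inverse_metric_differentiable frechet_derivative_works by blast
    \<comment> \<open>Only the derivative along coordinate lines is needed, and there
      \<open>d\<close> gives the entry explicitly.\<close>
    have H'_axis: "H' (Inr l) (Inr m) (axis (Inr l) 1) = d p l m" for l m
    proof -
      have line: "((\<lambda>s. p + s *\<^sub>R axis (Inr l) 1) has_derivative (\<lambda>s. s *\<^sub>R axis (Inr l) 1)) (at (0::real))"
        by (auto intro!: derivative_eq_intros)
      have "((\<lambda>s. inverse_metric (p + s *\<^sub>R axis (Inr l) 1) $ Inr l $ Inr m) has_derivative
          (\<lambda>s. H' (Inr l) (Inr m) (s *\<^sub>R axis (Inr l) 1))) (at (0::real))"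
        using has_derivative_compose[OF line, of "\<lambda>q. inverse_metric q $ Inr l $ Inr m"] H' by simp
      moreover have "((\<lambda>s. inverse_metric p $ Inr l $ Inr m + s * d p l m) has_derivative
          (\<lambda>s. s * d p l m)) (at (0::real))"
        by (auto intro!: derivative_eq_intros)
      ultimately have "(\<lambda>s. H' (Inr l) (Inr m) (s *\<^sub>R axis (Inr l) 1)) = (\<lambda>s. s * d p l m)"
        unfolding d by (rule has_derivative_unique)
      from fun_cong[OF this, of 1] show ?thesis by simp
    qed
    define G' where "G' m h = 2 * (\<Sum>n\<in>UNIV. C m n * of_real (h $ Inr n))" for m and h :: "real^('m + 'l)"
    have G': "(G m has_derivative G' m) (at p)" for m
    proof -
      have "((\<lambda>p. V m + 2 * (\<Sum>n\<in>UNIV. C m n * of_real (p $ Inr n))) has_derivative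
          (\<lambda>h. 0 + 2 * (\<Sum>n\<in>UNIV. C m n * of_real (h $ Inr n)))) (at p)"
        by (intro has_derivative_add has_derivative_const has_derivative_sum has_derivative_mult_right entry)
      then show ?thesis by (simp add: G_def[abs_def] G'_def[abs_def])
    qed
    define X' where "X' i h = (\<Sum>m\<in>UNIV. of_real (inverse_metric p $ i $ Inr m) * G' m h
        + of_real (H' i (Inr m) h) * G m p)" for i h
    have "((\<lambda>q. \<Sum>m\<in>UNIV. of_real (inverse_metric q $ i $ Inr m) * G m q) has_derivative X' i) (at p)" for i
      unfolding X'_def
      by (rule has_derivative_sum, rule has_derivative_mult[OF has_derivative_of_real[OF H'] G'])
    then have "((\<lambda>q. \<Sum>j\<in>UNIV. of_real (inverse_metric q $ i $ j) * f' q (axis j 1)) has_derivative X' i) (at p)" for i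
      by (simp add: sum_UNIV_Plus f'_Inl f'_Inr)
    from laplace_beltrami_eq[OF f this]
    have "laplace_beltrami g ?f p = (\<Sum>k\<in>UNIV. X' (Inl k) (axis (Inl k) 1)) + (\<Sum>l\<in>UNIV. X' (Inr l) (axis (Inr l) 1))"
      by (simp add: f'_Inl sum_UNIV_Plus)
    moreover have "X' (Inl k) h = 0" for k h
    proof -
      have "((\<lambda>q. inverse_metric q $ Inl k $ Inr m) has_derivative (\<lambda>h. 0)) (at p)" for m
        by (simp add: inverse_metric_Inl)
      then have "H' (Inl k) (Inr m) = (\<lambda>h. 0)" for m
        using has_derivative_unique[OF H'] by blast
      then show ?thesis by (simp add: X'_def inverse_metric_Inl)
    qed
    moreover have "X' (Inr l) (axis (Inr l) 1) = (\<Sum>m\<in>UNIV. of_real (d p l m) * G m p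
        + 2 * of_real (inverse_metric p $ Inr l $ Inr m) * C l m)" for l
      unfolding X'_def H'_axis
      by (intro sum.cong refl)
         (simp add: G'_def axis_def sym[of l] if_distrib[of of_real] if_distrib[of "\<lambda>x. _ * x"] cong: if_cong)
    ultimately show ?thesis
      using zero[of p] by (simp add: G_def)
  qed
  have "\<exists>p. ?f p \<noteq> 0"
  proof (rule ccontr)
    assume "\<not> ?thesis"
    then have "?f (\<chi> s. case s of Inl _ \<Rightarrow> 0 | Inr l \<Rightarrow> y l) = 0" for y by blast
    then have "a + (\<Sum>l\<in>UNIV. V l * of_real (y l))
        + (\<Sum>l\<in>UNIV. \<Sum>m\<in>UNIV. C l m * of_real (y l) * of_real (y m)) = 0" for y :: "'l \<Rightarrow> real"
      by simp
    from quadratic_function_eq_0[OF sym this] nontrivial show False by blast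
  qed
  moreover have "smooth (\<lambda>p :: real^('m + 'l). complex_of_real (p $ s))" for s
    by (rule smooth_compose_linear[OF bounded_linear_vec_nth smooth_bounded_linear[OF bounded_linear_of_real]])
  then have "smooth ?f"
    by (intro smooth_add smooth_const smooth_sum smooth_mult)
  ultimately show ?thesis
    by (simp add: proper_harmonic_def LB)
qed

end

section \<open>The left-invariant frames of the two groups\<close>

lemma jacobian_affine:
  assumes "\<And>q. f q = b + M *v q"
  shows "jacobian f p = M"
proof -
  have "(f has_derivative (*v) M) (at p)"
    unfolding assms[abs_def]
    using has_derivative_add[OF has_derivative_const bounded_linear_imp_has_derivative[OF matrix_vector_mul_bounded_linear]]
    by fastforce
  then have "frechet_derivative f (at p) = (*v) M"
    by (rule frechet_derivative_at[symmetric])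
  then show ?thesis by (simp add: jacobian_def)
qed

lemma has_derivative_matrix:
  fixes f :: "'a::real_normed_vector \<Rightarrow> real^'n^'m"
  assumes "\<And>i j. ((\<lambda>x. f x $ i $ j) has_derivative (\<lambda>h. f' h $ i $ j)) F"
  shows "(f has_derivative f') F"
  by (intro has_derivative_vec assms)

lemma t_part_0: "t_part 0 = 0"
  by (simp add: t_part_def vec_eq_iff)

lemma bounded_linear_t_part: "bounded_linear (t_part :: real^('m::finite + 'l::finite) \<Rightarrow> _)"
  by (simp add: linear_conv_bounded_linear[symmetric] linear_iff t_part_def vec_eq_iff)

lemma mu_0: "mu A 0 = mat 1"
  by (simp add: mu_def matrix_exp_0)

lemma has_derivative_mu:
  fixes A :: "'m::finite \<Rightarrow> real^'d^'d"
  assumes comm: "\<And>j k. A j ** A k = A k ** A j"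
  shows "((\<lambda>t. mu A t) has_derivative (\<lambda>h. (\<Sum>k\<in>UNIV. h $ k *\<^sub>R A k) ** mu A t)) (at t)"
  unfolding mu_def
proof (rule has_derivative_matrix_exp)
  show "bounded_linear (\<lambda>t. \<Sum>k\<in>UNIV. t $ k *\<^sub>R A k)"
    by (intro bounded_linear_sum bounded_linear_scaleR_left[THEN bounded_linear_compose] bounded_linear_vec_nth)
  show "(\<Sum>k\<in>UNIV. s $ k *\<^sub>R A k) ** (\<Sum>k\<in>UNIV. t $ k *\<^sub>R A k)
      = (\<Sum>k\<in>UNIV. t $ k *\<^sub>R A k) ** (\<Sum>k\<in>UNIV. s $ k *\<^sub>R A k)" for s t :: "real^'m"
    by (simp add: matrix_mult.sum_left matrix_mult.sum_right matrix_mult.scaleR_left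
        matrix_mult.scaleR_right scaleR_sum_right)
       (subst sum.swap, simp add: comm mult.commute)
qed

lemma has_derivative_mu_t_part:
  fixes A :: "'m::finite \<Rightarrow> real^'d^'d" and p :: "real^('m + 'l::finite)"
  assumes "\<And>j k. A j ** A k = A k ** A j"
  shows "((\<lambda>p. mu A (t_part p) $ i $ j) has_derivative
    (\<lambda>h. ((\<Sum>k\<in>UNIV. h $ Inl k *\<^sub>R A k) ** mu A (t_part p)) $ i $ j)) (at p)"
proof -
  have "((\<lambda>p. mu A (t_part p)) has_derivative (\<lambda>h. (\<Sum>k\<in>UNIV. t_part h $ k *\<^sub>R A k) ** mu A (t_part p))) (at p)"
    by (rule has_derivative_compose[OF bounded_linear_imp_has_derivative[OF bounded_linear_t_part] has_derivative_mu[OF assms]])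
  then show ?thesis
    by (intro bounded_linear.has_derivative[OF bounded_linear_vec_nth]) (simp add: t_part_def)
qed

section \<open>The frame over R^n\<close>

definition frame_Rn :: "('m::finite \<Rightarrow> real^'n::finite^'n) \<Rightarrow> real^('m + 'n) \<Rightarrow> real^('m + 'n)^('m + 'n)" where
  "frame_Rn A p = (\<chi> s u. case s of
     Inl k \<Rightarrow> axis (Inl k) 1 $ u
   | Inr i \<Rightarrow> (case u of Inl _ \<Rightarrow> 0 | Inr j \<Rightarrow> mu A (t_part p) $ i $ j))"

definition frame_log_deriv_Rn :: "('m::finite \<Rightarrow> real^'n::finite^'n) \<Rightarrow> real^('m + 'n) \<Rightarrow> real^('m + 'n)^('m + 'n)" where
  "frame_log_deriv_Rn A h = (\<chi> s u. case s of
     Inl k \<Rightarrow> 0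
   | Inr i \<Rightarrow> (case u of Inl _ \<Rightarrow> 0 | Inr j \<Rightarrow> (\<Sum>k\<in>UNIV. h $ Inl k *\<^sub>R A k) $ i $ j))"

lemma left_invariant_frame_Rn:
  assumes "commuting_invertible_family A"
  shows "left_invariant_frame (metric_Rn A) (frame_Rn A) (\<lambda>p. frame_log_deriv_Rn A) (omega_Rn A)"
proof
  have comm: "\<And>j k. A j ** A k = A k ** A j"
    using assms by (simp add: commuting_invertible_family_def)
  fix p h :: "real^('a + 'b)" and k :: 'a and i :: 'b
  have "mul_Rn A p q = p + frame_Rn A p *v q" for q
  proof -
    have "mul_Rn A p q $ s = (p + frame_Rn A p *v q) $ s" for s
      by (cases s) (simp_all add: mul_Rn_def pair_Rn_def frame_Rn_def t_part_def x_Rn_def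
          matrix_vector_mult_def sum_UNIV_Plus axis_def if_distrib[of "\<lambda>x. x * _"] cong: if_cong)
    then show ?thesis by (simp add: vec_eq_iff)
  qed
  then show "metric_Rn A p = transpose (matrix_inv (frame_Rn A p)) ** matrix_inv (frame_Rn A p)"
    by (simp add: metric_Rn_def left_invariant_metric_def jacobian_affine)
  show "(frame_Rn A has_derivative (\<lambda>h. frame_log_deriv_Rn A h ** frame_Rn A p)) (at p)"
  proof (rule has_derivative_matrix)
    fix s u
    show "((\<lambda>p. frame_Rn A p $ s $ u) has_derivative (\<lambda>h. (frame_log_deriv_Rn A h ** frame_Rn A p) $ s $ u)) (at p)"
      using has_derivative_mu_t_part[OF comm, where p = p]
      by (cases s; cases u)
         (simp_all add: frame_Rn_def frame_log_deriv_Rn_def matrix_matrix_mult_def sum_UNIV_Plus axis_def)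
  qed
  have "trace (frame_log_deriv_Rn A h) = (\<Sum>i\<in>UNIV. \<Sum>k\<in>UNIV. h $ Inl k * A k $ i $ i)"
    by (simp add: trace_def frame_log_deriv_Rn_def sum_UNIV_Plus)
  also have "\<dots> = (\<Sum>k\<in>UNIV. omega_Rn A k * h $ Inl k)"
    by (subst sum.swap) (simp add: omega_Rn_def trace_def sum_distrib_left mult.commute)
  finally show "trace (frame_log_deriv_Rn A h) = (\<Sum>k\<in>UNIV. omega_Rn A k * h $ Inl k)" .
  show "frame_Rn A 0 = mat 1"
    by (auto simp: vec_eq_iff frame_Rn_def t_part_0 mu_0 mat_def axis_def split: sum.split)
  show "frame_Rn A p $ Inl k = axis (Inl k) 1"
    by (simp add: vec_eq_iff frame_Rn_def)
  show "frame_Rn A p $ Inr i $ Inl k = 0"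
    by (simp add: frame_Rn_def)
qed

section \<open>The frame over the Heisenberg group\<close>

lemma linear_J2n: "linear J2n"
  by (auto simp: linear_iff J2n_def vec_eq_iff)

lemma J2n_axis_skew: "J2n (axis i 1) $ k = - J2n (axis k 1) $ i"
proof -
  have "(2::2) \<noteq> 1" by simp
  then show ?thesis
    using exhaust_2[of "snd i"] exhaust_2[of "snd k"]
    by (cases i; cases k) (auto simp: J2n_def axis_def)
qed

text \<open>The coefficients of \<open>y\<close> in the form \<open>1/2 <J x, mu(t) y>\<close>, the
  twist of the Heisenberg multiplication.\<close>

definition xi_row :: "('m::finite \<Rightarrow> real^('n::finite \<times> 2)^('n \<times> 2)) \<Rightarrow> real^'m \<Rightarrow> real^('n \<times> 2) \<Rightarrow> 'n \<times> 2 \<Rightarrow> real" where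
  "xi_row A t x j = 1 / 2 * (\<Sum>i\<in>UNIV. J2n x $ i * mu A t $ i $ j)"

definition frame_H :: "('m::finite \<Rightarrow> real^('n::finite \<times> 2)^('n \<times> 2)) \<Rightarrow>
    real^('m + unit + 'n \<times> 2) \<Rightarrow> real^('m + unit + 'n \<times> 2)^('m + unit + 'n \<times> 2)" where
  "frame_H A p = (\<chi> s u. case s of
     Inl k \<Rightarrow> axis (Inl k) 1 $ u
   | Inr (Inl _) \<Rightarrow> (case u of Inl _ \<Rightarrow> 0 | Inr (Inl _) \<Rightarrow> a_H A (t_part p)
       | Inr (Inr j) \<Rightarrow> xi_row A (t_part p) (x_H p) j)
   | Inr (Inr i) \<Rightarrow> (case u of Inl _ \<Rightarrow> 0 | Inr (Inl _) \<Rightarrow> 0 | Inr (Inr j) \<Rightarrow> mu A (t_part p) $ i $ j))"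

text \<open>The \<open>xi\<close>-row is forced: together with \<open>c * xi_row\<close>, coming
  from the diagonal entry \<open>c\<close>, it must reproduce the derivative of
  \<open>xi_row\<close>. This is the origin of the term
  \<open>- c * J2n (x_H p) $ j\<close>.\<close>

definition frame_log_deriv_H :: "('m::finite \<Rightarrow> real^('n::finite \<times> 2)^('n \<times> 2)) \<Rightarrow>
    real^('m + unit + 'n \<times> 2) \<Rightarrow> real^('m + unit + 'n \<times> 2) \<Rightarrow> real^('m + unit + 'n \<times> 2)^('m + unit + 'n \<times> 2)" where
  "frame_log_deriv_H A p h = (let
       S = (\<Sum>k\<in>UNIV. h $ Inl k *\<^sub>R A k);
       c = 1 / real CARD('n) * (\<Sum>k\<in>UNIV. trace (A k) * h $ Inl k)
     in \<chi> s u. case s of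
     Inl k \<Rightarrow> 0
   | Inr (Inl _) \<Rightarrow> (case u of Inl _ \<Rightarrow> 0 | Inr (Inl _) \<Rightarrow> c
       | Inr (Inr j) \<Rightarrow> 1 / 2 * (J2n (x_H h) $ j + (\<Sum>i\<in>UNIV. J2n (x_H p) $ i * S $ i $ j) - c * J2n (x_H p) $ j))
   | Inr (Inr i) \<Rightarrow> (case u of Inl _ \<Rightarrow> 0 | Inr (Inl _) \<Rightarrow> 0 | Inr (Inr j) \<Rightarrow> S $ i $ j))"

lemma has_derivative_a_H:
  fixes A :: "'m::finite \<Rightarrow> real^('n::finite \<times> 2)^('n \<times> 2)" and p :: "real^('m + 'l::finite)"
  shows "((\<lambda>p. a_H A (t_part p)) has_derivative
    (\<lambda>h. 1 / real CARD('n) * (\<Sum>k\<in>UNIV. trace (A k) * h $ Inl k) * a_H A (t_part p))) (at p)"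
proof -
  have "((\<lambda>p. 1 / real CARD('n) * (\<Sum>k\<in>UNIV. trace (A k) * p $ Inl k)) has_derivative
      (\<lambda>h. 1 / real CARD('n) * (\<Sum>k\<in>UNIV. trace (A k) * h $ Inl k))) (at p)"
    by (intro has_derivative_mult_right has_derivative_sum bounded_linear_imp_has_derivative bounded_linear_vec_nth)
  from has_derivative_exp[OF this] show ?thesis
    by (simp add: a_H_def t_part_def mult.commute)
qed

lemma has_derivative_xi_row:
  fixes A :: "'m::finite \<Rightarrow> real^('n::finite \<times> 2)^('n \<times> 2)" and p :: "real^('m + unit + 'n \<times> 2)"
  assumes comm: "\<And>j k. A j ** A k = A k ** A j"
  shows "((\<lambda>p. xi_row A (t_part p) (x_H p) j) has_derivative
    (\<lambda>h. 1 / 2 * (\<Sum>i\<in>UNIV. J2n (x_H p) $ i * ((\<Sum>k\<in>UNIV. h $ Inl k *\<^sub>R A k) ** mu A (t_part p)) $ i $ j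
       + J2n (x_H h) $ i * mu A (t_part p) $ i $ j))) (at p)"
proof -
  have "bounded_linear (\<lambda>p. J2n (x_H p) $ i)" for i
    unfolding linear_conv_bounded_linear[symmetric]
    by (auto simp: linear_iff J2n_def x_H_def)
  then show ?thesis
    unfolding xi_row_def
    by (intro has_derivative_mult_right has_derivative_sum has_derivative_mult has_derivative_mu_t_part comm
        bounded_linear_imp_has_derivative)
qed

lemma left_invariant_frame_H:
  fixes A :: "'m::finite \<Rightarrow> real^('n::finite \<times> 2)^('n \<times> 2)"
  assumes "commuting_invertible_family A"
  shows "left_invariant_frame (metric_H A) (frame_H A) (frame_log_deriv_H A) (omega_H A)"
proof
  have comm: "\<And>j k. A j ** A k = A k ** A j"
    using assms by (simp add: commuting_invertible_family_def)
  fix p h :: "real^('m + unit + 'n \<times> 2)" and k :: 'm and i :: "unit + 'n \<times> 2"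
  have "mul_H A p q = p + frame_H A p *v q" for q
  proof -
    have "J2n (x_H p) \<bullet> (mu A (t_part p) *v x_H q)
        = (\<Sum>j\<in>UNIV. (\<Sum>i\<in>UNIV. J2n (x_H p) $ i * mu A (t_part p) $ i $ j) * x_H q $ j)"
      unfolding inner_vec_def matrix_vector_mult_def
      by (simp add: sum_distrib_left sum_distrib_right mult.assoc) (rule sum.swap)
    then have xi: "1 / 2 * (J2n (x_H p) \<bullet> (mu A (t_part p) *v x_H q))
        = (\<Sum>j\<in>UNIV. xi_row A (t_part p) (x_H p) j * q $ Inr (Inr j))"
      by (simp only: xi_row_def mult.assoc sum_distrib_left[symmetric]) (simp add: x_H_def)
    have "mul_H A p q $ s = (p + frame_H A p *v q) $ s" for s
    proof -
      consider k where "s = Inl k" | "s = Inr (Inl ())" | i where "s = Inr (Inr i)"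
        by (metis old.sum.exhaust old.unit.exhaust)
      then show ?thesis
      proof cases
        case 2
        then show ?thesis
          unfolding mul_H_def xi
          by (simp add: triple_H_def frame_H_def xi_H_def
              matrix_vector_mult_def sum_UNIV_Plus UNIV_unit)
      qed (simp_all add: mul_H_def triple_H_def frame_H_def t_part_def x_H_def
          matrix_vector_mult_def sum_UNIV_Plus axis_def if_distrib[of "\<lambda>x. x * _"] cong: if_cong)
    qed
    then show ?thesis by (simp add: vec_eq_iff)
  qed
  then show "metric_H A p = transpose (matrix_inv (frame_H A p)) ** matrix_inv (frame_H A p)"
    by (simp add: metric_H_def left_invariant_metric_def jacobian_affine)
  show "(frame_H A has_derivative (\<lambda>h. frame_log_deriv_H A p h ** frame_H A p)) (at p)"
  proof (rule has_derivative_matrix)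
    fix s u :: "'m + unit + 'n \<times> 2"
    consider k where "s = Inl k" | "s = Inr (Inl ())" | i where "s = Inr (Inr i)"
      by (metis old.sum.exhaust old.unit.exhaust)
    then show "((\<lambda>p. frame_H A p $ s $ u) has_derivative (\<lambda>h. (frame_log_deriv_H A p h ** frame_H A p) $ s $ u)) (at p)"
    proof cases
      case 2
      consider k where "u = Inl k" | "u = Inr (Inl ())" | i where "u = Inr (Inr i)"
        by (metis old.sum.exhaust old.unit.exhaust)
      then show ?thesis
      proof cases
        case (3 l)
        let ?S = "\<lambda>h :: real^('m + unit + 'n \<times> 2). \<Sum>k\<in>UNIV. h $ Inl k *\<^sub>R A k"
        let ?c = "\<lambda>h :: real^('m + unit + 'n \<times> 2). 1 / real CARD('n) * (\<Sum>k\<in>UNIV. trace (A k) * h $ Inl k)"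
        let ?M = "mu A (t_part p)" and ?x = "J2n (x_H p)"
        \<comment> \<open>The contribution of \<open>c\<close> through the diagonal cancels against
          the one in the \<open>xi\<close>-row, leaving the derivative of
          \<open>xi_row\<close>.\<close>
        have "(frame_log_deriv_H A p h ** frame_H A p) $ s $ u
            = 1 / 2 * (\<Sum>i\<in>UNIV. ?x $ i * (?S h ** ?M) $ i $ l + J2n (x_H h) $ i * ?M $ i $ l)" for h
        proof -
          have "(frame_log_deriv_H A p h ** frame_H A p) $ s $ u = ?c h * xi_row A (t_part p) (x_H p) l
              + (\<Sum>j\<in>UNIV. 1 / 2 * (J2n (x_H h) $ j + (\<Sum>i\<in>UNIV. ?x $ i * ?S h $ i $ j) - ?c h * ?x $ j) * ?M $ j $ l)"
            by (simp add: 2 3 frame_H_def frame_log_deriv_H_def Let_def matrix_matrix_mult_def sum_UNIV_Plus UNIV_unit)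
          also have "(\<Sum>j\<in>UNIV. 1 / 2 * (J2n (x_H h) $ j + (\<Sum>i\<in>UNIV. ?x $ i * ?S h $ i $ j) - ?c h * ?x $ j) * ?M $ j $ l)
              = 1 / 2 * ((\<Sum>j\<in>UNIV. J2n (x_H h) $ j * ?M $ j $ l) + (\<Sum>j\<in>UNIV. (\<Sum>i\<in>UNIV. ?x $ i * ?S h $ i $ j) * ?M $ j $ l)
                 - ?c h * (\<Sum>j\<in>UNIV. ?x $ j * ?M $ j $ l))"
            unfolding sum_distrib_left sum.distrib[symmetric] sum_subtractf[symmetric]
            by (simp only: algebra_simps)
          also have "(\<Sum>j\<in>UNIV. (\<Sum>i\<in>UNIV. ?x $ i * ?S h $ i $ j) * ?M $ j $ l) = (\<Sum>i\<in>UNIV. ?x $ i * (?S h ** ?M) $ i $ l)"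
            unfolding matrix_matrix_mult_def vec_lambda_beta sum_distrib_left sum_distrib_right
            by (subst sum.swap) (simp only: mult.assoc)
          finally show ?thesis
            by (simp add: xi_row_def sum.distrib algebra_simps)
        qed
        moreover have "frame_H A p $ s $ u = xi_row A (t_part p) (x_H p) l" for p
          by (simp add: 2 3 frame_H_def)
        ultimately show ?thesis
          using has_derivative_xi_row[where A = A and p = p and j = l, OF comm] by (simp only:)
      qed (use has_derivative_a_H[of A p] 2 in \<open>simp_all add: frame_H_def frame_log_deriv_H_def Let_def
             matrix_matrix_mult_def sum_UNIV_Plus axis_def UNIV_unit\<close>)
    next
      case (3 i)
      consider k where "u = Inl k" | "u = Inr (Inl ())" | j where "u = Inr (Inr j)"
        by (metis old.sum.exhaust old.unit.exhaust)
      then show ?thesis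
        using has_derivative_mu_t_part[OF comm, where p = p and i = i]
        by cases (simp_all add: 3 frame_H_def frame_log_deriv_H_def Let_def
             matrix_matrix_mult_def sum_UNIV_Plus axis_def)
    qed (simp add: frame_H_def frame_log_deriv_H_def Let_def matrix_matrix_mult_def)
  qed
  \<comment> \<open>The diagonal holds \<open>c\<close> once and the diagonal of \<open>S\<close>;
    together they give the factor \<open>1/n + 1\<close> of \<open>omega_H\<close>.\<close>
  have "trace (frame_log_deriv_H A p h) = 1 / real CARD('n) * (\<Sum>k\<in>UNIV. trace (A k) * h $ Inl k)
      + (\<Sum>i\<in>UNIV. \<Sum>k\<in>UNIV. h $ Inl k * A k $ i $ i)"
    by (simp add: trace_def frame_log_deriv_H_def Let_def sum_UNIV_Plus UNIV_unit)
  also have "(\<Sum>i\<in>UNIV. \<Sum>k\<in>UNIV. h $ Inl k * A k $ i $ i) = (\<Sum>k\<in>UNIV. trace (A k) * h $ Inl k)"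
    by (subst sum.swap) (simp add: trace_def sum_distrib_left mult.commute)
  also have "1 / real CARD('n) * (\<Sum>k\<in>UNIV. trace (A k) * h $ Inl k) + (\<Sum>k\<in>UNIV. trace (A k) * h $ Inl k)
      = (\<Sum>k\<in>UNIV. omega_H A k * h $ Inl k)"
    by (simp add: omega_H_def sum_distrib_left sum.distrib[symmetric] add_divide_distrib algebra_simps)
  finally show "trace (frame_log_deriv_H A p h) = (\<Sum>k\<in>UNIV. omega_H A k * h $ Inl k)" .
  have "J2n (x_H (0 :: real^('m + unit + 'n \<times> 2))) = 0"
    by (simp add: x_H_def J2n_def vec_eq_iff)
  then have "xi_row A t (x_H (0 :: real^('m + unit + 'n \<times> 2))) j = 0" for t j
    by (simp add: xi_row_def)
  then show "frame_H A 0 = mat 1"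
    by (auto simp: vec_eq_iff frame_H_def t_part_0 mu_0 mat_def axis_def a_H_def split: sum.split)
  show "frame_H A p $ Inl k = axis (Inl k) 1"
    by (simp add: vec_eq_iff frame_H_def)
  show "frame_H A p $ Inr i $ Inl k = 0"
    by (simp add: frame_H_def split: sum.split)
qed

section \<open>Harmonicity of the quadratic functions\<close>

lemma trace_complex_matrix:
  "trace (complex_matrix M ** B) = (\<Sum>i\<in>UNIV. \<Sum>j\<in>UNIV. of_real (M $ i $ j) * B $ j $ i)"
  unfolding trace_def complex_matrix_def matrix_matrix_mult_def by simp

lemma symmetric_matrix_nth: "transpose B = B \<Longrightarrow> B $ i $ j = B $ j $ i"
  by (metis transpose_def vec_lambda_beta)

text \<open>The fibre block \<open>mu mu^T\<close> of the inverse metric depends on \<open>t\<close>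
  only, so the slopes \<open>d\<close> are 0 and what remains is twice the trace in the
  assumption.\<close>

lemma proper_harmonic_quadratic_Rn:
  fixes A :: "'m::finite \<Rightarrow> real^'n::finite^'n" and B :: "complex^'n^'n"
  assumes A: "commuting_invertible_family A"
    and nontrivial: "\<not> (a = 0 \<and> v = 0 \<and> B = 0)" and sym: "transpose B = B"
    and trace: "\<And>t. trace (complex_matrix (mu A t ** transpose (mu A t)) ** B) = 0"
  shows "proper_harmonic (metric_Rn A) 1
    (\<lambda>p. a + (\<Sum>i\<in>UNIV. v $ i * complex_of_real (x_Rn p $ i))
       + (\<Sum>i\<in>UNIV. \<Sum>j\<in>UNIV. B $ i $ j * complex_of_real (x_Rn p $ i) * complex_of_real (x_Rn p $ j)))"
proof -
  interpret left_invariant_frame "metric_Rn A" "frame_Rn A" "\<lambda>p. frame_log_deriv_Rn A" "omega_Rn A"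
    by (rule left_invariant_frame_Rn[OF A])
  have H: "inverse_metric p $ Inr l $ Inr m = (mu A (t_part p) ** transpose (mu A (t_part p))) $ l $ m" for p l m
    by (simp add: inverse_metric_def frame_Rn_def matrix_matrix_mult_def transpose_def sum_UNIV_Plus)
  have t: "t_part (p + s *\<^sub>R axis (Inr l) 1) = t_part p" for p :: "real^('m + 'n)" and s l
    by (simp add: t_part_def axis_def vec_eq_iff)
  have Bsym: "B $ l $ m = B $ m $ l" for l m by (rule symmetric_matrix_nth[OF sym])
  have "(\<Sum>l\<in>UNIV. \<Sum>m\<in>UNIV. of_real (inverse_metric p $ Inr l $ Inr m) * B $ l $ m) = 0" for p
    using trace[of "t_part p"] by (simp add: trace_complex_matrix H Bsym)
  then have "(\<Sum>l\<in>UNIV. \<Sum>m\<in>UNIV. 2 * of_real (inverse_metric p $ Inr l $ Inr m) * B $ l $ m) = 0" for p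
    by (simp add: mult.assoc flip: sum_distrib_left)
  with nontrivial show ?thesis
    using proper_harmonic_quadratic[of "\<lambda>l m. B $ l $ m" a "\<lambda>l. v $ l" "\<lambda>_ _ _. 0"]
    by (simp add: Bsym H t x_Rn_def vec_eq_iff)
qed

text \<open>Exchanging the indices turns the sum into its negative, as \<open>M\<close> is symmetric
  and \<open>J2n\<close> skew.\<close>

lemma sum_J2n_symmetric:
  assumes "\<And>i k. M $ i $ k = M $ k $ i"
  shows "(\<Sum>i\<in>UNIV. \<Sum>k\<in>UNIV. M $ i $ k * J2n (axis i 1) $ k) = 0"
proof -
  let ?s = "\<Sum>i\<in>UNIV. \<Sum>k\<in>UNIV. M $ i $ k * J2n (axis i 1) $ k"
  have "?s = (\<Sum>i\<in>UNIV. \<Sum>k\<in>UNIV. M $ k $ i * - J2n (axis k 1) $ i)"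
    by (simp only: assms[symmetric] J2n_axis_skew[symmetric])
  also have "\<dots> = - ?s"
    by (subst sum.swap) (simp add: sum_negf)
  finally show ?thesis by simp
qed

text \<open>\<open>xi\<close> enters as one more fibre coordinate with linear coefficient
  \<open>b\<close> and no quadratic part. The only non-zero slopes are those of the entries coupling
  \<open>x\<close> to \<open>xi\<close>; they contribute \<open>b\<close> times a sum that vanishes
  by skewness of \<open>J2n\<close>.\<close>

lemma proper_harmonic_quadratic_H:
  fixes A :: "'m::finite \<Rightarrow> real^('n::finite \<times> 2)^('n \<times> 2)" and B :: "complex^('n \<times> 2)^('n \<times> 2)"
  assumes A: "commuting_invertible_family A"
    and nontrivial: "\<not> (a = 0 \<and> b = 0 \<and> v = 0 \<and> B = 0)" and sym: "transpose B = B"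
    and trace: "\<And>t. trace (complex_matrix (mu A t ** transpose (mu A t)) ** B) = 0"
  shows "proper_harmonic (metric_H A) 1
    (\<lambda>p. a + b * complex_of_real (xi_H p) + (\<Sum>i\<in>UNIV. v $ i * complex_of_real (x_H p $ i))
       + (\<Sum>i\<in>UNIV. \<Sum>j\<in>UNIV. B $ i $ j * complex_of_real (x_H p $ i) * complex_of_real (x_H p $ j)))"
proof -
  interpret left_invariant_frame "metric_H A" "frame_H A" "frame_log_deriv_H A" "omega_H A"
    by (rule left_invariant_frame_H[OF A])
  define V where "V l = (case l of Inl _ \<Rightarrow> b | Inr i \<Rightarrow> v $ i)" for l :: "unit + 'n \<times> 2"
  define C where "C l m = (case l of Inl _ \<Rightarrow> 0 | Inr i \<Rightarrow> (case m of Inl _ \<Rightarrow> 0 | Inr j \<Rightarrow> B $ i $ j))"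
    for l m :: "unit + 'n \<times> 2"
  \<comment> \<open>The slope in the coordinate \<open>x_i\<close> of the inverse metric entry that
    couples \<open>x_i\<close> to \<open>xi\<close>.\<close>
  define e where "e p i = (\<Sum>j\<in>UNIV. mu A (t_part p) $ i $ j * xi_row A (t_part p) (axis i 1) j)"
    for p :: "real^('m + unit + 'n \<times> 2)" and i
  \<comment> \<open>Along \<open>xi\<close> the inverse metric does not change, and its
    \<open>x\<close>-block depends on \<open>t\<close> alone.\<close>
  define d where "d p l m = (case l of Inl _ \<Rightarrow> 0 | Inr i \<Rightarrow> (case m of Inl _ \<Rightarrow> e p i | Inr _ \<Rightarrow> 0))"
    for p and l m :: "unit + 'n \<times> 2"
  have V [simp]: "V (Inl u) = b" "V (Inr i) = v $ i" for u i
    by (simp_all add: V_def)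
  have C [simp]: "C (Inl u) l = 0" "C l (Inl u) = 0" "C (Inr i) (Inr j) = B $ i $ j" for u l i j
    by (simp_all add: C_def split: sum.split)
  have d [simp]: "d p (Inl u) l = 0" "d p (Inr i) (Inl u) = e p i" "d p (Inr i) (Inr j) = 0" for p u l i j
    by (simp_all add: d_def)
  have Hxx: "inverse_metric p $ Inr (Inr i) $ Inr (Inr j) = (mu A (t_part p) ** transpose (mu A (t_part p))) $ i $ j" for p i j
    by (simp add: inverse_metric_def frame_H_def matrix_matrix_mult_def transpose_def sum_UNIV_Plus)
  have Hxxi: "inverse_metric p $ Inr (Inr i) $ Inr (Inl u)
      = (\<Sum>j\<in>UNIV. mu A (t_part p) $ i $ j * xi_row A (t_part p) (x_H p) j)" for p i u
    by (simp add: inverse_metric_def frame_H_def matrix_matrix_mult_def transpose_def sum_UNIV_Plus)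
  have Hxi: "inverse_metric p $ Inr (Inl u) $ Inr m = (case m of
        Inl _ \<Rightarrow> (a_H A (t_part p))\<^sup>2 + (\<Sum>j\<in>UNIV. (xi_row A (t_part p) (x_H p) j)\<^sup>2)
      | Inr i \<Rightarrow> (\<Sum>j\<in>UNIV. xi_row A (t_part p) (x_H p) j * mu A (t_part p) $ i $ j))" for p u m
    by (cases m) (simp_all add: inverse_metric_def frame_H_def matrix_matrix_mult_def transpose_def
        sum_UNIV_Plus UNIV_unit power2_eq_square)
  have t: "t_part (p + s *\<^sub>R axis (Inr l) 1) = t_part p" for p :: "real^('m + unit + 'n \<times> 2)" and s l
    by (simp add: t_part_def axis_def vec_eq_iff)
  have x: "x_H (p + s *\<^sub>R axis (Inr (Inl u)) 1) = x_H p"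
    "x_H (p + s *\<^sub>R axis (Inr (Inr i)) 1) = x_H p + s *\<^sub>R axis i 1"
    for p :: "real^('m + unit + 'n \<times> 2)" and s u i
    by (simp_all add: x_H_def axis_def vec_eq_iff)
  have row: "xi_row A t (x + s *\<^sub>R y) j = xi_row A t x j + s * xi_row A t y j" for t x s y j
    by (simp add: xi_row_def linear_add[OF linear_J2n] linear_cmul[OF linear_J2n] algebra_simps
        sum.distrib sum_distrib_left)
  have d_eq: "inverse_metric (p + s *\<^sub>R axis (Inr l) 1) $ Inr l $ Inr m
      = inverse_metric p $ Inr l $ Inr m + s * d p l m" for p l m s
    by (cases l; cases m)
       (simp_all add: Hxx Hxxi Hxi t x row e_def distrib_left sum.distrib sum_distrib_left mult_ac)
  have Bsym: "B $ l $ m = B $ m $ l" for l m by (rule symmetric_matrix_nth[OF sym])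
  have sum_e: "(\<Sum>i\<in>UNIV. e p i) = 0" for p
  proof -
    let ?M = "mu A (t_part p)"
    have "e p i = 1 / 2 * (\<Sum>k\<in>UNIV. (?M ** transpose ?M) $ i $ k * J2n (axis i 1) $ k)" for i
      unfolding e_def xi_row_def matrix_matrix_mult_def transpose_def vec_lambda_beta sum_distrib_left sum_distrib_right
      by (subst sum.swap) (simp only: mult_ac)
    then have "(\<Sum>i\<in>UNIV. e p i) = 1 / 2 * (\<Sum>i\<in>UNIV. \<Sum>k\<in>UNIV. (?M ** transpose ?M) $ i $ k * J2n (axis i 1) $ k)"
      by (simp only: sum_distrib_left)
    also have "\<dots> = 0"
      by (subst sum_J2n_symmetric) (simp_all add: matrix_matrix_mult_def transpose_def mult.commute)
    finally show ?thesis .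
  qed
  have "(\<Sum>i\<in>UNIV. \<Sum>j\<in>UNIV. of_real (inverse_metric p $ Inr (Inr i) $ Inr (Inr j)) * B $ i $ j) = 0" for p
    using trace[of "t_part p"] by (simp add: trace_complex_matrix Hxx Bsym)
  then have trace': "(\<Sum>i\<in>UNIV. \<Sum>j\<in>UNIV. 2 * of_real (inverse_metric p $ Inr (Inr i) $ Inr (Inr j)) * B $ i $ j) = 0" for p
    by (simp add: mult.assoc flip: sum_distrib_left)
  have zero: "(\<Sum>l\<in>UNIV. \<Sum>m\<in>UNIV. of_real (d p l m) * (V m + 2 * (\<Sum>n\<in>UNIV. C m n * of_real (p $ Inr n)))
      + 2 * of_real (inverse_metric p $ Inr l $ Inr m) * C l m) = 0" for p
  proof -
    have "(\<Sum>i\<in>UNIV. complex_of_real (e p i) * b) = 0"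
      by (simp add: sum_e flip: sum_distrib_right of_real_sum)
    with trace'[of p] show ?thesis
      by (simp add: sum_UNIV_Plus UNIV_unit sum.distrib)
  qed
  have Csym: "C l m = C m l" for l m
    by (cases l; cases m) (simp_all add: Bsym)
  have "a \<noteq> 0 \<or> (\<exists>l. V l \<noteq> 0) \<or> (\<exists>l m. C l m \<noteq> 0)"
  proof (rule ccontr)
    assume "\<not> ?thesis"
    then have "a = 0" "V l = 0" "C l m = 0" for l m by auto
    then have "a = 0" "b = 0" "v $ i = 0" "B $ i $ j = 0" for i j
      using V C(3) by metis+
    with nontrivial show False by (simp add: vec_eq_iff)
  qed
  from proper_harmonic_quadratic[OF Csym this d_eq zero]
  show ?thesis
    by (simp add: sum_UNIV_Plus UNIV_unit xi_H_def x_H_def add.assoc)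
qed

theorem proposition5p4:
  fixes A :: "'m::finite \<Rightarrow> real^'n^'n"
    and AH :: "'m \<Rightarrow> real^('h::{finite,linorder} \<times> 2)^('h \<times> 2)"
  shows
    "(commuting_invertible_family A \<longrightarrow>
        (\<forall>(a::complex) (v::complex^'n) (B::complex^'n^'n).
           \<not> (a = 0 \<and> v = 0 \<and> B = 0) \<longrightarrow>
           transpose B = B \<longrightarrow>
           (\<forall>t. trace (complex_matrix (mu A t ** transpose (mu A t)) ** B) = 0) \<longrightarrow>
           proper_harmonic (metric_Rn A) 1
             (\<lambda>p. a + (\<Sum>i\<in>UNIV. v $ i * complex_of_real (x_Rn p $ i))
                    + (\<Sum>i\<in>UNIV. \<Sum>j\<in>UNIV.
                         B $ i $ j * complex_of_real (x_Rn p $ i) * complex_of_real (x_Rn p $ j))))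
      \<and> (\<forall>(r::'m \<Rightarrow> nat) (c1::complex) (c2::complex).
           (\<forall>k. r k \<ge> 1) \<longrightarrow>
           (c1, c2) \<noteq> (0, 0) \<longrightarrow>
           (\<forall>k. proper_harmonic (metric_Rn A) (r k)
                  (\<lambda>p. phi c1 c2 (omega_Rn A k) (r k) (t_part p $ k)))
         \<and> proper_harmonic (metric_Rn A) ((\<Sum>k\<in>UNIV. r k) - CARD('m) + 1)
             (\<lambda>p. \<Prod>k\<in>UNIV. phi c1 c2 (omega_Rn A k) (r k) (t_part p $ k))))
   \<and> (commuting_invertible_family AH \<and> (\<forall>k. heisenberg_form (AH k)) \<longrightarrow>
        (\<forall>(a::complex) (b::complex) (v::complex^('h \<times> 2)) (B::complex^('h \<times> 2)^('h \<times> 2)).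
           \<not> (a = 0 \<and> b = 0 \<and> v = 0 \<and> B = 0) \<longrightarrow>
           transpose B = B \<longrightarrow>
           (\<forall>t. trace (complex_matrix (mu AH t ** transpose (mu AH t)) ** B) = 0) \<longrightarrow>
           proper_harmonic (metric_H AH) 1
             (\<lambda>p. a + b * complex_of_real (xi_H p)
                    + (\<Sum>i\<in>UNIV. v $ i * complex_of_real (x_H p $ i))
                    + (\<Sum>i\<in>UNIV. \<Sum>j\<in>UNIV.
                         B $ i $ j * complex_of_real (x_H p $ i) * complex_of_real (x_H p $ j))))
      \<and> (\<forall>(r::'m \<Rightarrow> nat) (c1::complex) (c2::complex).
           (\<forall>k. r k \<ge> 1) \<longrightarrow>
           (c1, c2) \<noteq> (0, 0) \<longrightarrow>
           (\<forall>k. proper_harmonic (metric_H AH) (r k)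
                  (\<lambda>p. phi c1 c2 (omega_H AH k) (r k) (t_part p $ k)))
         \<and> proper_harmonic (metric_H AH) ((\<Sum>k\<in>UNIV. r k) - CARD('m) + 1)
             (\<lambda>p. \<Prod>k\<in>UNIV. phi c1 c2 (omega_H AH k) (r k) (t_part p $ k))))"
proof -
  have t: "t_part p $ k = p $ Inl k" for p :: "real^('m + 'l::finite)" and k
    by (simp add: t_part_def)
  note Rn = left_invariant_frame.proper_harmonic_phi[OF left_invariant_frame_Rn]
    left_invariant_frame.proper_harmonic_prod_phi[OF left_invariant_frame_Rn]
  note H = left_invariant_frame.proper_harmonic_phi[OF left_invariant_frame_H]
    left_invariant_frame.proper_harmonic_prod_phi[OF left_invariant_frame_H]
  show ?thesis
    unfolding t
    by (intro conjI impI allI; (elim conjE)?;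
        rule proper_harmonic_quadratic_Rn proper_harmonic_quadratic_H Rn H; blast)
qed

end
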